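(* Let $q$ be a prime power and $k$ a positive integer, and put $N=\frac{q^{2k}-1}{q^k-1}=q^k+1$. Then $$P(2k,k,q)\ \ge\ \frac{|\mathrm{GL}(2k,q)|}{L},$$ where $$\begin{aligned}L={}&N^{2}q^{k^{2}}|\mathrm{GL}(k,q)|^{2}-\tfrac12\big(N(N-1)\big)^{2}|\mathrm{GL}(k,q)|^{2}+\tfrac{1}{3!}\big(N(N-1)(N-2)\big)^{2}|\mathrm{GL}(k,q)|\\&+\sum_{i=4}^{N}\frac{(-1)^{i+1}}{i!}\big(N(N-1)(N-2)\big)^{2}\sum_{l\mid k}\left(\left|\mathrm{GL}\!\left(\tfrac{k}{l},q^{l}\right)\right|-\left|\bigcup_{\substack{m\mid k\\ l\mid m,\ m\neq l}}\mathrm{GL}\!\left(\tfrac{k}{m},q^{m}\right)\rtimes\mathrm{Gal}(\mathbb{F}_{q^m}/\mathbb{F}_q)\right|\right) l\,[q^{l}-2]_{i-3},\end{aligned}$$ and $[a]_{j}=a(a-1)\cdots(a-j+1)$.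
   Context: $V(n,q)$ denotes an $n$-dimensional vector space over the finite field $\mathbb{F}_q$, and $\mathrm{GL}(n,q)$ is the group of invertible $\mathbb{F}_q$-linear maps of it. A $k$-spread of $V(n,q)$ (where $k\mid n$) is a set of $k$-dimensional $\mathbb{F}_q$-subspaces of $V(n,q)$ such that every nonzero vector lies in exactly one of them. A partial $k$-parallelism of $V(n,q)$ is a collection of $k$-spreads of $V(n,q)$ that are pairwise disjoint as sets of subspaces (no $k$-dimensional subspace belongs to two of the spreads). $P(n,k,q)$ denotes the maximum size (number of spreads) of a partial $k$-parallelism of $V(n,q)$. For a divisor $m$ of $k$, the group $\mathrm{GL}(k/m,q^m)\rtimes\mathrm{Gal}(\mathbb{F}_{q^m}/\mathbb{F}_q)$ is viewed as a subgroup of $\mathrm{GL}(k,q)$, the group of invertible $\mathbb{F}_q$-linear maps of $\mathbb{F}_{q^k}$: it consists of all bijective $\mathbb{F}_q$-linear maps $\varphi:\mathbb{F}_{q^k}\to\mathbb{F}_{q^k}$ for which there is $\sigma\in\mathrm{Gal}(\mathbb{F}_{q^m}/\mathbb{F}_q)$ with $\varphi(vx)=\sigma(v)\varphi(x)$ for all $v\in\mathbb{F}_{q^m}$, $x\in\mathbb{F}_{q^k}$. The unions are taken inside this $\mathrm{GL}(k,q)$; an empty union (e.g. when $l=k$) has size $0$. *)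

theory Defs
  imports
    Complex_Main
    "HOL-Library.FuncSet"
    "HOL-Library.Cardinality"
    "HOL-Algebra.Algebraic_Closure_Type"
begin

definition k_spread ::
  "('f::field \<Rightarrow> 'v::ab_group_add \<Rightarrow> 'v) \<Rightarrow> nat \<Rightarrow> 'v set set \<Rightarrow> bool" where
  "k_spread scale k S \<longleftrightarrow>
     (\<forall>W\<in>S. Modules.module.subspace scale W \<and> vector_space.dim scale W = k) \<and>
     (\<forall>v. v \<noteq> 0 \<longrightarrow> (\<exists>!W. W \<in> S \<and> v \<in> W))"

definition partial_k_parallelism ::
  "('f::field \<Rightarrow> 'v::ab_group_add \<Rightarrow> 'v) \<Rightarrow> nat \<Rightarrow> 'v set set set \<Rightarrow> bool" where
  "partial_k_parallelism scale k \<P> \<longleftrightarrow>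
     (\<forall>S\<in>\<P>. k_spread scale k S) \<and> pairwise disjnt \<P>"

(* P(n,k,q), where n and q are the dimension and the order of the scalar field of the vector
   space given by scale. Meant for finite spaces, where the maximum is over a finite set. *)
definition max_k_parallelism ::
  "('f::field \<Rightarrow> 'v::ab_group_add \<Rightarrow> 'v) \<Rightarrow> nat \<Rightarrow> nat" where
  "max_k_parallelism scale k = Max (card ` {\<P>. partial_k_parallelism scale k \<P>})"

definition general_linear ::
  "('f::field \<Rightarrow> 'v::ab_group_add \<Rightarrow> 'v) \<Rightarrow> ('v \<Rightarrow> 'v) set" where
  "general_linear scale = {\<phi>. Vector_Spaces.linear scale scale \<phi> \<and> bij \<phi>}"

(* The field with q^m elements, q = CARD('f), inside the algebraic closure of the finite field
   'f: the roots of X^(q^m) - X. The base field is GF 1, and GF m is contained in GF k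
   for m dvd k. *)
definition GF :: "nat \<Rightarrow> 'f::{field,finite} alg_closure set" where
  "GF m = {x. x ^ (CARD('f) ^ m) = x}"

(* GL(k/m, q^m), for m dvd k: GF k serves as the vector space of dimension k/m over GF m.
   Maps on GF k are represented by total functions that are undefined outside GF k. *)
definition GL_ext ::
  "nat \<Rightarrow> nat \<Rightarrow> ('f::{field,finite} alg_closure \<Rightarrow> 'f alg_closure) set" where
  "GL_ext k m = {\<phi> \<in> extensional (GF k). bij_betw \<phi> (GF k) (GF k) \<and>
     (\<forall>x\<in>GF k. \<forall>y\<in>GF k. \<phi> (x + y) = \<phi> x + \<phi> y) \<and>
     (\<forall>v\<in>GF m. \<forall>x\<in>GF k. \<phi> (v * x) = v * \<phi> x)}"

(* Gal(F_{q^m} / F_q) *)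
definition Gal :: "nat \<Rightarrow> ('f::{field,finite} alg_closure \<Rightarrow> 'f alg_closure) set" where
  "Gal m = {\<sigma> \<in> extensional (GF m). bij_betw \<sigma> (GF m) (GF m) \<and>
     (\<forall>u\<in>GF m. \<forall>v\<in>GF m. \<sigma> (u + v) = \<sigma> u + \<sigma> v \<and> \<sigma> (u * v) = \<sigma> u * \<sigma> v) \<and>
     (\<forall>c\<in>GF 1. \<sigma> c = c)}"

(* The subgroup GL(k/m, q^m) : Gal(F_{q^m} / F_q) of GL(k,q), for m dvd k *)
definition semilinear_ext ::
  "nat \<Rightarrow> nat \<Rightarrow> ('f::{field,finite} alg_closure \<Rightarrow> 'f alg_closure) set" where
  "semilinear_ext k m = {\<phi> \<in> GL_ext k 1.
     \<exists>\<sigma>\<in>Gal m. \<forall>v\<in>GF m. \<forall>x\<in>GF k. \<phi> (v * x) = \<sigma> v * \<phi> x}"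

(* [a]_j = a (a - 1) ... (a - j + 1) *)
definition falling :: "real \<Rightarrow> nat \<Rightarrow> real" where
  "falling a j = (\<Prod>t<j. a - real t)"

end

theory Submission
  imports Defs "HOL-Library.Product_Plus"
begin

text \<open>
  Identify the space with \<open>K\<^sup>2\<close>, where \<open>K\<close> is the field with \<open>q\<^sup>k\<close> elements, let \<open>D\<close> be the spread of
  the \<open>N\<close> lines of \<open>K\<^sup>2\<close>, and let \<open>X\<close> be the set of all \<open>g\<close> in \<open>GL(2k,q)\<close> such that \<open>g D\<close> and \<open>D\<close>
  share a member. If \<open>M\<close> is a maximal set of \<open>g\<close> with pairwise disjoint \<open>g D\<close>, then the translates
  \<open>h X\<close> for \<open>h \<in> M\<close> cover the group, so \<open>card M\<close> is at least \<open>card GL(2k,q) / card X\<close>, and it remains to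
  see that \<open>card X \<le> L\<close>.

  For \<open>n(g)\<close>, the number of members of \<open>D\<close> that \<open>g\<close> maps into \<open>D\<close>, the inclusion-exclusion formula
  has a closed form: the indicator of \<open>n > 0\<close> is \<open>n - [n]\<^sub>2 / 2 + [n]\<^sub>3 / (2 n)\<close>. As \<open>GL(2,K)\<close> preserves
  \<open>D\<close> and is triply transitive on it, summing over \<open>g\<close> reduces to the pointwise stabilizers of one, two
  and three standard lines. They consist of triangular matrices, of diagonal matrices, and of the
  scalar matrices \<open>diag(\<phi>,\<phi>)\<close> with \<open>\<phi> \<in> GL(k,q)\<close>. In the last case \<open>n = q\<^sup>l + 1\<close>, where
  \<open>{a \<in> K. \<phi> a \<phi>\<^sup>-\<^sup>1 \<in> K}\<close> is the subfield with \<open>q\<^sup>l\<close> elements.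
\<close>

subsection \<open>Subfields of the algebraic closure of a finite field\<close>

text \<open>Multiplication by a nonzero \<open>x\<close> permutes the nonzero elements of
  \<open>A\<close>; comparing their products gives \<open>x ^ (card A - 1) = 1\<close>. Stated for
  multiplicatively closed sets so that it serves both the base field and the finite subrings of its
  closure.\<close>

lemma power_card_eq_self:
  fixes A :: "'a::field set"
  assumes fin: "finite A" and mult: "\<And>x y. x \<in> A \<Longrightarrow> y \<in> A \<Longrightarrow> x * y \<in> A" and x: "x \<in> A" and z: "0 \<in> A"
  shows "x ^ card A = x"
proof (cases "x = 0")
  case True
  with fin x show ?thesis by (auto simp: card_gt_0_iff)
next
  case False
  have inj: "inj_on ((*) x) (A - {0})" using False by (auto intro: inj_onI)
  have "(*) x ` (A - {0}) = A - {0}"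
    using fin inj x False by (intro endo_inj_surj) (auto intro: mult)
  hence "\<Prod>(A - {0}) = (\<Prod>y\<in>A - {0}. x * y)"
    using prod.reindex[OF inj, of id] by simp
  also have "\<dots> = x ^ card (A - {0}) * \<Prod>(A - {0})" by (simp add: prod.distrib)
  finally have "x ^ card (A - {0}) = 1" using fin by (auto simp: prod_zero_iff)
  moreover have "card A = Suc (card (A - {0}))" using fin z by (metis card.remove)
  ultimately show ?thesis by simp
qed

lemma CARD_field_gt_1: "CARD('f::{field,finite}) > 1"
proof -
  have "card {0, 1::'f} \<le> CARD('f)" by (intro card_mono) auto
  thus ?thesis by simp
qed

text \<open>The polynomial \<open>(X + 1)^q - X^q - 1\<close> has degree less than \<open>q\<close> and vanishes on all of \<open>'f\<close>.\<close>
lemma of_nat_CARD_choose: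
  assumes "0 < i" "i < CARD('f)"
  shows "(of_nat (CARD('f) choose i) :: 'f::{field,finite}) = 0"
proof -
  let ?q = "CARD('f)"
  define p :: "'f poly" where "p = (\<Sum>j\<in>{0<..<?q}. monom (of_nat (?q choose j)) j)"
  have self: "x ^ ?q = x" for x :: 'f
    using power_card_eq_self[of UNIV x] by simp
  have eq: "{..?q} = insert 0 (insert ?q {0<..<?q})" by auto
  have "poly p x = 0" for x
  proof -
    have "x + 1 = (\<Sum>j\<le>?q. of_nat (?q choose j) * x ^ j)"
      using binomial_ring[of x 1 ?q] self[of "x + 1"] by simp
    also have "\<dots> = 1 + x ^ ?q + poly p x"
      unfolding eq p_def using CARD_field_gt_1[where 'f='f]
      by (subst sum.insert, simp, simp, subst sum.insert) (auto simp: poly_sum poly_monom)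
    finally show ?thesis by (simp add: self)
  qed
  hence roots: "{x. poly p x = 0} = UNIV" by auto
  have "degree p \<le> ?q - 1"
    unfolding p_def by (intro degree_sum_le) (auto intro: order.trans[OF degree_monom_le])
  hence "degree p < ?q" using CARD_field_gt_1[where 'f='f] by simp
  hence "p = 0" using card_poly_roots_bound[of p] roots by auto
  hence "0 = coeff p i" by simp
  also have "\<dots> = of_nat (?q choose i)"
    unfolding p_def using assms by (simp add: coeff_sum coeff_monom)
  finally show ?thesis by simp
qed

text \<open>For a single \<open>q\<close>-th power, \<open>q\<close> being the order of the base
  field, the inner binomial coefficients vanish in the base field and hence in its closure. The
  general case iterates this.\<close>

lemma frobenius_add:
  fixes x y :: "'f::{field,finite} alg_closure"
  shows "(x + y) ^ (CARD('f) ^ m) = x ^ (CARD('f) ^ m) + y ^ (CARD('f) ^ m)"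
proof (induction m arbitrary: x y)
  case (Suc m)
  let ?q = "CARD('f)"
  have eq: "{..?q} = insert 0 (insert ?q {0<..<?q})" by auto
  have z: "(of_nat (?q choose i) :: 'f alg_closure) = 0" if "0 < i" "i < ?q" for i
    using of_nat_CARD_choose[OF that] by (metis to_ac_0 to_ac_of_nat)
  have "(x + y) ^ ?q = (\<Sum>j\<le>?q. of_nat (?q choose j) * x ^ j * y ^ (?q - j))" for x y :: "'f alg_closure"
    by (rule binomial_ring)
  also have "\<dots> x y = x ^ ?q + y ^ ?q" for x y
    unfolding eq using CARD_field_gt_1[where 'f='f]
    by (subst sum.insert, simp, simp, subst sum.insert) (auto simp: z add.commute)
  finally have "(x + y) ^ ?q = x ^ ?q + y ^ ?q" for x y :: "'f alg_closure" .
  thus ?case by (simp add: power_mult Suc.IH)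
qed simp

lemma frobenius_uminus:
  fixes x :: "'f::{field,finite} alg_closure"
  shows "(- x) ^ (CARD('f) ^ m) = - (x ^ (CARD('f) ^ m))"
proof -
  have "0 = (x + - x) ^ (CARD('f) ^ m)" by simp
  also have "\<dots> = x ^ (CARD('f) ^ m) + (- x) ^ (CARD('f) ^ m)" by (rule frobenius_add)
  finally show ?thesis by (simp add: eq_neg_iff_add_eq_0 add.commute)
qed

lemma GF_0 [simp]: "0 \<in> GF m" and GF_1 [simp]: "1 \<in> GF m"
  by (simp_all add: GF_def)

lemma GF_add [intro]: "x \<in> GF m \<Longrightarrow> y \<in> GF m \<Longrightarrow> x + y \<in> GF m"
  by (simp add: GF_def frobenius_add)

lemma GF_uminus [intro]: "x \<in> GF m \<Longrightarrow> - x \<in> GF m"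
  by (simp add: GF_def frobenius_uminus)

lemma GF_mult [intro]: "x \<in> GF m \<Longrightarrow> y \<in> GF m \<Longrightarrow> x * y \<in> GF m"
  by (simp add: GF_def power_mult_distrib)

lemma GF_inverse [intro]: "x \<in> GF m \<Longrightarrow> inverse x \<in> GF m"
  by (simp add: GF_def power_inverse)

lemma GF_power [intro]: "x \<in> GF m \<Longrightarrow> x ^ n \<in> GF m"
  by (induction n) auto

lemma power_CARD_mult:
  fixes x :: "'f::{field,finite} alg_closure"
  assumes "x \<in> GF m"
  shows "x ^ (CARD('f) ^ (m * a)) = x"
proof (induction a)
  case (Suc a)
  have "x ^ (CARD('f) ^ (m * Suc a)) = (x ^ (CARD('f) ^ m)) ^ (CARD('f) ^ (m * a))"
    by (simp add: power_add power_mult[symmetric])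
  with assms Suc show ?case by (simp add: GF_def)
qed simp

lemma GF_mono: "m dvd k \<Longrightarrow> GF m \<subseteq> GF k"
  by (auto simp: GF_def[of k] power_CARD_mult elim!: dvdE)

text \<open>The Frobenius powers with exponents \<open>a * u\<close> and \<open>b * v\<close> from
  Bezout's identity both fix \<open>x\<close>; as the exponents differ by \<open>gcd a b\<close>,
  the power with exponent \<open>gcd a b\<close> fixes it too.\<close>

lemma GF_Int_subset:
  assumes "a \<noteq> 0"
  shows "GF a \<inter> GF b \<subseteq> (GF (gcd a b) :: 'f::{field,finite} alg_closure set)"
proof
  fix x :: "'f alg_closure" assume x: "x \<in> GF a \<inter> GF b"
  obtain u v where uv: "a * u = b * v + gcd a b"
    using bezout_nat[OF assms] by blast
  have "x = x ^ (CARD('f) ^ (a * u))" using x power_CARD_mult by force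
  also have "\<dots> = (x ^ (CARD('f) ^ (b * v))) ^ (CARD('f) ^ gcd a b)"
    by (simp add: uv power_add power_mult)
  also have "x ^ (CARD('f) ^ (b * v)) = x" using x power_CARD_mult by force
  finally show "x \<in> GF (gcd a b)" by (simp add: GF_def)
qed

text \<open>The polynomial X^(q^k) - X splits in the closure, and its derivative is the constant -1.
  So it has no double root, and the number of its roots is its degree.\<close>

lemma card_GF:
  assumes "k > 0"
  shows "card (GF k :: 'f::{field,finite} alg_closure set) = CARD('f) ^ k"
    and finite_GF: "finite (GF k :: 'f alg_closure set)"
proof -
  let ?Q = "CARD('f) ^ k"
  have Q: "?Q > 1" using CARD_field_gt_1[where 'f='f] assms by (intro one_less_power)
  define p :: "'f alg_closure poly" where "p = monom 1 ?Q - monom 1 1"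
  have deg: "degree p = ?Q"
    unfolding p_def using Q by (subst diff_conv_add_uminus, subst degree_add_eq_left) (auto simp: degree_monom_eq)
  hence p0: "p \<noteq> 0" using Q by auto
  have root: "poly p x = 0 \<longleftrightarrow> x \<in> GF k" for x
    by (simp add: p_def poly_monom GF_def)
  \<comment> \<open>The order \<open>q\<close> of the field vanishes in it, being the binomial
    coefficient \<open>q choose 1\<close>; this is what reduces the derivative to -1.\<close>
  have "(of_nat CARD('f) :: 'f) = 0"
    using of_nat_CARD_choose[of 1, where 'f='f] CARD_field_gt_1[where 'f='f] by simp
  hence "(of_nat CARD('f) :: 'f alg_closure) = 0" by (metis to_ac_0 to_ac_of_nat)
  hence "(of_nat ?Q :: 'f alg_closure) = 0" using assms by simp
  hence pderiv: "pderiv p = - 1"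
    by (simp add: p_def pderiv_diff pderiv_monom)
  obtain A where A: "size A = degree p" "p = smult (lead_coeff p) (\<Prod>x\<in>#A. [:-x, 1:])"
    using alg_closed_imp_factorization[OF p0] by blast
  have simple: "count A x \<le> 1" for x
  proof (rule ccontr)
    assume "\<not> count A x \<le> 1"
    hence "count {#x, x#} y \<le> count A y" for y by auto
    hence "{#x, x#} \<subseteq># A" by (simp add: subseteq_mset_def)
    then obtain B where "A = {#x, x#} + B" by (metis subset_mset.le_iff_add)
    then have "p = [:-x, 1:] * ([:-x, 1:] * smult (lead_coeff p) (\<Prod>x\<in>#B. [:-x, 1:]))"
      using A(2) by (simp add: mult_ac)
    then obtain r where r: "p = [:-x, 1:] * ([:-x, 1:] * r)" by blast
    have "poly (pderiv p) x = 0" unfolding r pderiv_mult poly_add poly_mult by simp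
    thus False by (simp add: pderiv)
  qed
  have set: "set_mset A = GF k"
  proof -
    have "poly p x = lead_coeff p * (\<Prod>a\<in>#A. x - a)" for x
      by (subst A(2)) (simp add: poly_prod_mset image_mset.compositionality o_def)
    hence "poly p x = 0 \<longleftrightarrow> x \<in># A" for x using p0 by (auto simp: prod_mset_zero_iff)
    with root show ?thesis by blast
  qed
  have "size A = card (set_mset A)"
    unfolding size_multiset_overloaded_eq using simple
    by (metis (mono_tags, lifting) One_nat_def card_eq_sum count_greater_eq_one_iff order_antisym sum.cong)
  with A(1) set deg show "card (GF k :: 'f alg_closure set) = CARD('f) ^ k" by simp
  show "finite (GF k :: 'f alg_closure set)" using set by (metis finite_set_mset)
qed

lemma GF_base: "GF 1 = range (to_ac :: 'f::{field,finite} \<Rightarrow> 'f alg_closure)"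
proof -
  have "range (to_ac :: 'f \<Rightarrow> 'f alg_closure) \<subseteq> GF 1"
    using power_card_eq_self[of "UNIV :: 'f set"] by (auto simp: GF_def simp flip: to_ac_power)
  moreover have "card (range (to_ac :: 'f \<Rightarrow> 'f alg_closure)) = card (GF 1 :: 'f alg_closure set)"
    by (simp add: card_GF card_image inj_to_ac)
  ultimately show ?thesis
    using card_subset_eq[OF finite_GF[of 1, where 'f='f]] by (metis zero_less_one)
qed

text \<open>\<open>GF a\<close> equals its intersection with \<open>GF b\<close>, hence lies in
  \<open>GF (gcd a b)\<close>, and cardinalities force \<open>a \<le> gcd a b\<close>.\<close>

lemma GF_subset_imp_dvd:
  assumes "a > 0" "GF a \<subseteq> (GF b :: 'f::{field,finite} alg_closure set)"
  shows "a dvd b"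
proof -
  have g: "gcd a b > 0" using assms by simp
  have "GF a \<subseteq> (GF (gcd a b) :: 'f alg_closure set)" using GF_Int_subset[of a b] assms by blast
  hence "CARD('f) ^ a \<le> CARD('f) ^ gcd a b"
    using card_mono[OF finite_GF[OF g]] card_GF[OF g] card_GF[OF assms(1)] by metis
  hence "a \<le> gcd a b" using CARD_field_gt_1[where 'f='f] by simp
  thus ?thesis using assms(1) by (metis gcd_dvd1 gcd_dvd2 dvd_imp_le le_antisym)
qed

section \<open>Dimension and cardinality over a finite field\<close>

text \<open>Induction over the basis: a new vector \<open>b\<close> multiplies the count by the
  number of its coefficients, since (c, x) -> c b + x is a bijection onto the larger span.\<close>

lemma card_span_independent:
  fixes scale :: "'f::{field,finite} \<Rightarrow> 'v::ab_group_add \<Rightarrow> 'v"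
  assumes "vector_space scale" "finite B" "\<not> module.dependent scale B"
  shows "finite (module.span scale B)" "card (module.span scale B) = CARD('f) ^ card B"
proof -
  interpret vector_space scale by fact
  have "finite (span B) \<and> card (span B) = CARD('f) ^ card B"
    using assms(2,3)
  proof (induction B)
    case (insert b B)
    have ind: "independent B" using insert.prems by (meson dependent_mono subset_insertI)
    have b: "b \<notin> span B"
      using insert by (metis dependent_def Diff_insert_absorb insertI1)
    let ?f = "\<lambda>(c, x). scale c b + x"
    have "bij_betw ?f (UNIV \<times> span B) (span (insert b B))"
    proof (rule bij_betwI')
      fix s t :: "'f \<times> 'v" assume st: "s \<in> UNIV \<times> span B" "t \<in> UNIV \<times> span B"
      obtain c x d y where [simp]: "s = (c, x)" "t = (d, y)" by fastforce
      show "(?f s = ?f t) = (s = t)"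
      proof
        assume eq: "?f s = ?f t"
        hence *: "scale (c - d) b = y - x" by (simp add: algebra_simps scale_left_diff_distrib)
        have "scale (c - d) b \<in> span B" using st by (simp add: * span_diff)
        \<comment> \<open>If \<open>c\<close> and \<open>d\<close> differed, dividing by
          \<open>c - d\<close> would put \<open>b\<close> into the span of the other
          vectors.\<close>
        hence "c = d" using b span_scale[of "scale (c - d) b" B "inverse (c - d)"] by (cases "c = d") auto
        with eq show "s = t" by simp
      qed simp
    next
      fix s :: "'f \<times> 'v" assume "s \<in> UNIV \<times> span B"
      thus "?f s \<in> span (insert b B)"
        by (auto simp: span_insert intro!: exI[of _ "fst s"])
    next
      fix x assume "x \<in> span (insert b B)"
      then obtain c where "x - scale c b \<in> span B" by (auto simp: span_insert)
      thus "\<exists>s\<in>UNIV \<times> span B. x = ?f s" by (intro bexI[of _ "(c, x - scale c b)"]) auto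
    qed
    from bij_betw_same_card[OF this] bij_betw_finite[OF this]
    show ?case using insert ind by (simp add: card_cartesian_product)
  qed simp
  thus "finite (span B)" "card (span B) = CARD('f) ^ card B" by auto
qed

text \<open>Lets dimensions be read off from cardinalities, which is how they are determined
  below.\<close>

lemma card_subspace:
  fixes scale :: "'f::{field,finite} \<Rightarrow> 'v::ab_group_add \<Rightarrow> 'v"
  assumes vs: "vector_space scale" and W: "module.subspace scale W" "finite W"
  shows "card W = CARD('f) ^ vector_space.dim scale W"
proof -
  interpret vector_space scale by fact
  obtain B where B: "B \<subseteq> W" "independent B" "W \<subseteq> span B" "card B = dim W"
    using basis_exists by blast
  have "span B = W" using B W span_minimal by blast
  thus ?thesis using card_span_independent[OF vs finite_subset[OF B(1) W(2)] B(2)] B(4) by simp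
qed

definition ac_scale :: "'f::field \<Rightarrow> 'f alg_closure \<Rightarrow> 'f alg_closure" where
  "ac_scale c x = to_ac c * x"

lemma vector_space_ac_scale: "vector_space ac_scale"
  by unfold_locales (simp_all add: ac_scale_def algebra_simps)

text \<open>A finite subring \<open>A\<close> over the base field is a subspace, hence has q^l
  elements. All of them satisfy x^(q^l) = x, so \<open>A\<close> lies in \<open>GF l\<close>, which
  has the same size.\<close>

lemma subring_eq_GF:
  fixes A :: "'f::{field,finite} alg_closure set"
  assumes fin: "finite A" and base: "GF 1 \<subseteq> A"
    and add: "\<And>x y. x \<in> A \<Longrightarrow> y \<in> A \<Longrightarrow> x + y \<in> A"
    and mult: "\<And>x y. x \<in> A \<Longrightarrow> y \<in> A \<Longrightarrow> x * y \<in> A"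
  obtains l where "l > 0" "A = GF l"
proof -
  interpret ac: vector_space ac_scale by (rule vector_space_ac_scale)
  have z: "0 \<in> A" using base GF_0 by blast
  have "to_ac c \<in> A" for c using base unfolding GF_base by blast
  hence sub: "ac.subspace A"
    unfolding ac.subspace_def using z add mult by (simp add: ac_scale_def)
  define l where "l = ac.dim A"
  have card: "card A = CARD('f) ^ l" unfolding l_def by (rule card_subspace[OF vector_space_ac_scale sub fin])
  have "{0, 1} \<subseteq> A" using base GF_0 GF_1 by blast
  hence "card {0, 1 :: 'f alg_closure} \<le> card A" by (rule card_mono[OF fin])
  hence "2 \<le> card A" by simp
  hence l: "l > 0" using card by (cases l) auto
  have "A \<subseteq> GF l"
    using power_card_eq_self[OF fin mult _ z] by (auto simp: GF_def card)
  hence "A = GF l" using card_GF[OF l, where 'f='f] card finite_GF[OF l] by (intro card_subset_eq) auto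
  with l show ?thesis using that by blast
qed

subsection \<open>The group action on a Desarguesian spread\<close>

text \<open>Tuples are lists so that a map acts on them through \<open>map\<close> and prefixes are
  available through \<open>take\<close>.\<close>

definition distinct_lists :: "nat \<Rightarrow> 'a set \<Rightarrow> 'a list set" where
  "distinct_lists m A = {xs. length xs = m \<and> distinct xs \<and> set xs \<subseteq> A}"

lemma finite_distinct_lists: "finite A \<Longrightarrow> finite (distinct_lists m A)"
  by (rule finite_subset[OF _ finite_lists_length_eq[of A m]]) (auto simp: distinct_lists_def)

lemma falling_of_nat_eq_0: "n < m \<Longrightarrow> falling (real n) m = 0"
  unfolding falling_def by (rule prod_zero) auto

lemma falling_small: "falling x 1 = x" "falling x (Suc 0) = x" "falling x 2 = x * (x - 1)"
    "falling x 3 = x * (x - 1) * (x - 2)"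
  by (simp_all add: falling_def numeral_eq_Suc lessThan_Suc)

lemma card_distinct_lists:
  assumes "finite A"
  shows "real (card (distinct_lists m A)) = falling (real (card A)) m"
proof (cases "m \<le> card A")
  case True
  have "falling (real (card A)) m = (\<Prod>t<m. real (card A - t))"
    unfolding falling_def using True by (intro prod.cong) auto
  also have "\<dots> = real (\<Prod>t<m. card A - t)" by simp
  also have "(\<Prod>t<m. card A - t) = \<Prod>{card A - m + 1..card A}"
    by (rule prod.reindex_bij_witness[of _ "\<lambda>j. card A - j" "\<lambda>t. card A - t"]) (use True in auto)
  also have "\<dots> = card (distinct_lists m A)"
    unfolding distinct_lists_def using card_lists_distinct_length_eq[OF assms True] by simp
  finally show ?thesis ..
next
  \<comment> \<open>For \<open>m\<close> above \<open>card A\<close> both sides vanish: the product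
    has a factor 0.\<close>
  case False
  have "length xs \<le> card A" if "distinct xs" "set xs \<subseteq> A" for xs
    using card_mono[OF assms that(2)] distinct_card[OF that(1)] by simp
  hence "distinct_lists m A = {}" using False by (auto simp: distinct_lists_def)
  thus ?thesis using False by (simp add: falling_of_nat_eq_0)
qed

text \<open>Reduces transitivity on shorter tuples to transitivity on triples.\<close>

lemma extend_distinct_list:
  assumes "finite A" "n \<le> card A" "m \<le> n" "xs \<in> distinct_lists m A"
  obtains ys where "ys \<in> distinct_lists n A" "take m ys = xs"
proof -
  obtain zs where zs: "set zs = A - set xs" "distinct zs"
    using finite_distinct_list[of "A - set xs"] assms(1) by auto
  have xs: "length xs = m" "distinct xs" "set xs \<subseteq> A"
    using assms(4) by (auto simp: distinct_lists_def)
  have d: "distinct (xs @ zs)" and s: "set (xs @ zs) = A" using xs zs by auto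
  have "length (xs @ zs) = card A" using distinct_card[OF d] s by simp
  hence "take n (xs @ zs) \<in> distinct_lists n A"
    using d s set_take_subset[of n "xs @ zs"] assms(2) distinct_take[OF d]
    unfolding distinct_lists_def by auto
  moreover have "take m (take n (xs @ zs)) = xs" using assms(3) xs by simp
  ultimately show ?thesis using that by blast
qed

text \<open>The inclusion-exclusion sum over the sizes at least \<open>3\<close>, in closed form.\<close>
lemma indicator_pos_falling:
  "(if n > 0 then 1 else 0 :: real) =
     falling (real n) 1 - falling (real n) 2 / 2 + 1 / (2 * real n) * falling (real n) 3"
  by (simp add: falling_def numeral_eq_Suc lessThan_Suc field_simps)

text \<open>HOL-Algebra reserves the notation \<open>inv\<close> for the inverse in a group structure.\<close>
abbreviation map_inv :: "('v \<Rightarrow> 'v) \<Rightarrow> 'v \<Rightarrow> 'v" where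
  "map_inv \<equiv> inv_into UNIV"

section \<open>Coordinates over \<open>K\<close> and the lines of the Desarguesian spread\<close>

text \<open>Presents \<open>'v\<close> as the plane over \<open>K\<close>, with coordinates
  \<open>cx\<close> and \<open>cy\<close>; \<open>mk\<close> builds a vector from them and is
  unspecified outside \<open>K\<close>. \<open>K\<close> is a set and not a type because it will be
  \<open>GF k\<close>, which varies with \<open>k\<close>; \<open>emb\<close> embeds the scalar
  field.\<close>

locale coordinatized_space =
  fixes K :: "'a::field set" and emb :: "'f::field \<Rightarrow> 'a"
    and scale :: "'f \<Rightarrow> 'v::ab_group_add \<Rightarrow> 'v"
    and cx cy :: "'v \<Rightarrow> 'a" and mk :: "'a \<Rightarrow> 'a \<Rightarrow> 'v"
  assumes finite_K: "finite K"
    and K_0 [simp]: "0 \<in> K" and K_1 [simp]: "1 \<in> K"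
    and K_add [simp]: "x \<in> K \<Longrightarrow> y \<in> K \<Longrightarrow> x + y \<in> K"
    and K_uminus [simp]: "x \<in> K \<Longrightarrow> - x \<in> K"
    and K_mult [simp]: "x \<in> K \<Longrightarrow> y \<in> K \<Longrightarrow> x * y \<in> K"
    and K_inverse [simp]: "x \<in> K \<Longrightarrow> inverse x \<in> K"
    and emb_K [simp]: "emb c \<in> K"
    and vs: "vector_space scale"
    and cx_K [simp]: "cx v \<in> K" and cy_K [simp]: "cy v \<in> K"
    and cx_mk [simp]: "x \<in> K \<Longrightarrow> y \<in> K \<Longrightarrow> cx (mk x y) = x"
    and cy_mk [simp]: "x \<in> K \<Longrightarrow> y \<in> K \<Longrightarrow> cy (mk x y) = y"
    and mk_cx_cy [simp]: "mk (cx v) (cy v) = v"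
    and cx_add [simp]: "cx (u + v) = cx u + cx v" and cy_add [simp]: "cy (u + v) = cy u + cy v"
    and cx_scale [simp]: "cx (scale c v) = emb c * cx v"
    and cy_scale [simp]: "cy (scale c v) = emb c * cy v"
begin

lemma cx_0 [simp]: "cx 0 = 0" and cy_0 [simp]: "cy 0 = 0"
  by (metis add_0 add_cancel_right_right cx_add) (metis add_0 add_cancel_right_right cy_add)

lemma vec_eqI: "cx u = cx v \<Longrightarrow> cy u = cy v \<Longrightarrow> u = v"
  by (metis mk_cx_cy)

lemma vec_eq_iff: "u = v \<longleftrightarrow> cx u = cx v \<and> cy u = cy v"
  by (metis mk_cx_cy)

lemma finite_V: "finite (UNIV :: 'v set)"
proof -
  have "v \<in> (\<lambda>(x, y). mk x y) ` (K \<times> K)" for v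
    by (rule image_eqI[of _ _ "(cx v, cy v)"]) simp_all
  hence "UNIV = (\<lambda>(x, y). mk x y) ` (K \<times> K)" by blast
  thus ?thesis using finite_K by (metis finite_SigmaI finite_imageI)
qed

text \<open>Multiplication by scalars from \<open>K\<close>; on the scalars \<open>emb c\<close> it
  agrees with \<open>scale\<close>.\<close>

definition sm :: "'a \<Rightarrow> 'v \<Rightarrow> 'v" where
  "sm c v = mk (c * cx v) (c * cy v)"

lemma cx_sm [simp]: "c \<in> K \<Longrightarrow> cx (sm c v) = c * cx v"
  and cy_sm [simp]: "c \<in> K \<Longrightarrow> cy (sm c v) = c * cy v"
  by (simp_all add: sm_def)

text \<open>For nonzero \<open>u\<close>, the \<open>K\<close>-line through \<open>u\<close>, that
  is, a point of the projective line over \<open>K\<close>.\<close>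

definition pt :: "'v \<Rightarrow> 'v set" where
  "pt u = (\<lambda>c. sm c u) ` K"

definition D :: "'v set set" where
  "D = pt ` (UNIV - {0})"

lemma self_in_pt: "u \<in> pt u"
  unfolding pt_def by (rule image_eqI[of _ _ 1]) (auto simp: vec_eq_iff)

lemma pt_eqI:
  assumes "v \<in> pt u" "v \<noteq> 0"
  shows "pt v = pt u"
proof -
  obtain c where c: "c \<in> K" "v = sm c u" using assms by (auto simp: pt_def)
  have c0: "c \<noteq> 0" using c assms by (auto simp: vec_eq_iff)
  have "sm d v = sm (d * c) u" "sm d u = sm (d * inverse c) v" if "d \<in> K" for d
    using that c c0 by (simp_all add: vec_eq_iff)
  thus ?thesis unfolding pt_def using c
    by (metis (no_types, lifting) K_inverse K_mult image_subsetI rev_image_eqI subset_antisym)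
qed

lemma D_eq_pt: "W \<in> D \<Longrightarrow> v \<in> W \<Longrightarrow> v \<noteq> 0 \<Longrightarrow> W = pt v"
  by (auto simp: D_def pt_eqI)

lemma pt_in_D: "v \<noteq> 0 \<Longrightarrow> pt v \<in> D"
  by (simp add: D_def)

lemma mem_pt_slope:
  assumes a: "a \<in> K"
  shows "v \<in> pt (mk 1 a) \<longleftrightarrow> cy v = a * cx v"
proof
  assume v: "cy v = a * cx v"
  have "v = sm (cx v) (mk 1 a)" using a v by (simp add: vec_eq_iff)
  thus "v \<in> pt (mk 1 a)" by (auto simp: pt_def)
qed (use a in \<open>auto simp: pt_def\<close>)

lemma mem_pt_infinity: "v \<in> pt (mk 0 1) \<longleftrightarrow> cx v = 0"
proof
  assume "cx v = 0"
  hence "v = sm (cy v) (mk 0 1)" by (simp add: vec_eq_iff)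
  thus "v \<in> pt (mk 0 1)" by (auto simp: pt_def)
qed (auto simp: pt_def)

lemma mk_neq_0 [simp]: "a \<in> K \<Longrightarrow> mk 1 a \<noteq> 0" "mk 0 1 \<noteq> 0"
  by (auto simp: vec_eq_iff)

text \<open>A vector with \<open>cx v \<noteq> 0\<close> lies on the line whose slope is
  \<open>cy v\<close> divided by \<open>cx v\<close>; the remaining nonzero vectors lie on the line
  x = 0, the line at infinity. This gives the count \<open>card K + 1\<close>.\<close>

lemma D_eq: "D = insert (pt (mk 0 1)) ((\<lambda>a. pt (mk 1 a)) ` K)"
proof
  show "D \<subseteq> insert (pt (mk 0 1)) ((\<lambda>a. pt (mk 1 a)) ` K)"
  proof
    fix W assume "W \<in> D"
    then obtain v where v: "v \<noteq> 0" "W = pt v" by (auto simp: D_def)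
    show "W \<in> insert (pt (mk 0 1)) ((\<lambda>a. pt (mk 1 a)) ` K)"
    proof (cases "cx v = 0")
      case True
      hence "v \<in> pt (mk 0 1)" by (simp add: mem_pt_infinity)
      thus ?thesis using v pt_eqI by blast
    next
      case False
      have "v \<in> pt (mk 1 (cy v * inverse (cx v)))" using False by (simp add: mem_pt_slope)
      hence "W = pt (mk 1 (cy v * inverse (cx v)))" using v pt_eqI by blast
      thus ?thesis by simp
    qed
  qed
  show "insert (pt (mk 0 1)) ((\<lambda>a. pt (mk 1 a)) ` K) \<subseteq> D"
    using pt_in_D mk_neq_0 by blast
qed

lemma inj_slope: "inj_on (\<lambda>a. pt (mk 1 a)) K"
  by (rule inj_onI) (metis K_1 cx_mk cy_mk mem_pt_slope mult.right_neutral self_in_pt)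

lemma infinity_not_slope: "a \<in> K \<Longrightarrow> pt (mk 0 1) \<noteq> pt (mk 1 a)"
  using mem_pt_infinity[of "mk 1 a"] self_in_pt[of "mk 1 a"] by auto

lemma finite_D: "finite D"
  by (simp add: D_eq finite_K)

lemma card_D: "card D = card K + 1"
  unfolding D_eq using infinity_not_slope
  by (subst card_insert_disjoint) (auto simp: finite_K card_image[OF inj_slope])

lemma card_D_ge_3: "3 \<le> card D"
  using card_mono[OF finite_K, of "{0, 1}"] by (simp add: card_D)

lemma ex1_D: "v \<noteq> 0 \<Longrightarrow> \<exists>!W. W \<in> D \<and> v \<in> W"
  using D_eq_pt self_in_pt pt_in_D by (intro ex1I[of _ "pt v"]) auto

section \<open>The general linear group over the small field and the stabilizer of
  \<open>D\<close>\<close>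

abbreviation G :: "('v \<Rightarrow> 'v) set" where
  "G \<equiv> general_linear scale"

lemma G_iff: "g \<in> G \<longleftrightarrow>
  bij g \<and> (\<forall>u v. g (u + v) = g u + g v) \<and> (\<forall>c v. g (scale c v) = scale c (g v))"
  using vs unfolding general_linear_def Vector_Spaces.linear_iff by blast

lemma finite_G: "finite G"
proof -
  have "G \<subseteq> UNIV \<rightarrow>\<^sub>E UNIV" by (auto simp: PiE_def)
  thus ?thesis by (rule finite_subset) (intro finite_PiE finite_V)
qed

lemma G_id: "id \<in> G"
  by (simp add: G_iff)

lemma G_comp: "g \<in> G \<Longrightarrow> h \<in> G \<Longrightarrow> g \<circ> h \<in> G"
  by (simp add: G_iff bij_comp)

lemma G_inv:
  assumes "g \<in> G"
  shows "map_inv g \<in> G"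
proof -
  have b: "bij g" and add: "g (u + v) = g u + g v" and hom: "g (scale c v) = scale c (g v)" for u v c
    using assms by (simp_all add: G_iff)
  have fi: "g (map_inv g v) = v" for v using b by (simp add: bij_is_surj surj_f_inv_f)
  have eqI: "g x = g y \<Longrightarrow> x = y" for x y using b by (simp add: bij_is_inj inj_eq)
  have "map_inv g (u + v) = map_inv g u + map_inv g v" for u v by (rule eqI) (simp add: fi add)
  moreover have "map_inv g (scale c v) = scale c (map_inv g v)" for c v by (rule eqI) (simp add: fi hom)
  ultimately show ?thesis unfolding G_iff using bij_imp_bij_inv[OF b] by blast
qed

lemma G_bij: "g \<in> G \<Longrightarrow> bij g"
  by (simp add: G_iff)

lemma G_0:
  assumes "g \<in> G"
  shows "g 0 = 0"
proof -
  have "g (0 + 0) = g 0 + g 0" using assms unfolding G_iff by blast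
  thus ?thesis by simp
qed

lemma image_inv_image [simp]: "bij g \<Longrightarrow> g ` map_inv g ` W = W" "bij g \<Longrightarrow> map_inv g ` g ` W = W"
  by (simp_all add: bij_is_surj image_f_inv_f bij_is_inj image_inv_f_f)

definition stab_D :: "('v \<Rightarrow> 'v) set" where
  "stab_D = {s \<in> G. (`) s ` D = D}"

lemma stab_D_inv: "s \<in> stab_D \<Longrightarrow> map_inv s \<in> stab_D"
proof -
  assume "s \<in> stab_D"
  hence s: "s \<in> G" "(`) s ` D = D" by (auto simp: stab_D_def)
  have "(`) (map_inv s) ` (`) s ` D = D"
    by (simp only: image_image[of "(`) (map_inv s)" "(`) s"] image_inv_image(2)[OF G_bij[OF s(1)]] image_ident)
  with s show ?thesis by (auto simp: stab_D_def G_inv)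
qed

lemma stab_D_image: "s \<in> stab_D \<Longrightarrow> s ` W \<in> D \<longleftrightarrow> W \<in> D"
proof -
  assume s: "s \<in> stab_D"
  hence b: "bij s" by (auto simp: stab_D_def intro: G_bij)
  show ?thesis
  proof
    assume "s ` W \<in> D"
    hence "map_inv s ` s ` W \<in> (`) (map_inv s) ` D" by blast
    thus "W \<in> D" using stab_D_inv[OF s] b by (simp add: stab_D_def)
  qed (use s in \<open>auto simp: stab_D_def\<close>)
qed

text \<open>The \<open>K\<close>-linear map with columns \<open>u\<close> and \<open>v\<close>: it
  sends \<open>mk 1 0\<close> to \<open>u\<close> and \<open>mk 0 1\<close> to
  \<open>v\<close>.\<close>

definition comb :: "'v \<Rightarrow> 'v \<Rightarrow> 'v \<Rightarrow> 'v" where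
  "comb u v w = sm (cx w) u + sm (cy w) v"

text \<open>Being \<open>K\<close>-linear, the map takes lines to lines; being injective on a finite
  space, it permutes them. A kernel vector with \<open>cy w \<noteq> 0\<close> would make
  \<open>v\<close> a \<open>K\<close>-multiple of \<open>u\<close>, against
  \<open>pt u \<noteq> pt v\<close>.\<close>

lemma comb_in_stab_D:
  assumes uv: "u \<noteq> 0" "v \<noteq> 0" "pt u \<noteq> pt v"
  shows "comb u v \<in> stab_D" and comb_pt: "comb u v ` pt w = pt (comb u v w)"
proof -
  let ?s = "comb u v"
  have add: "?s (x + y) = ?s x + ?s y" for x y
    by (auto simp: comb_def vec_eq_iff algebra_simps)
  have hom: "?s (sm c x) = sm c (?s x)" if "c \<in> K" for c x
    using that by (auto simp: comb_def vec_eq_iff algebra_simps)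
  have scale: "?s (scale c x) = scale c (?s x)" for c x
    by (auto simp: comb_def vec_eq_iff algebra_simps)
  have ker: "w = 0" if w: "?s w = 0" for w
  proof -
    have y: "cy w = 0"
    proof (rule ccontr)
      assume y: "cy w \<noteq> 0"
      have "cx w * cx u + cy w * cx v = 0" "cx w * cy u + cy w * cy v = 0"
        using w by (auto simp: comb_def vec_eq_iff)
      moreover have "d = - a * inverse c * b" if "a * b + c * d = 0" "c \<noteq> 0" for a b c d :: 'a
      proof -
        have "c * d = - (a * b)" using that(1) by (simp add: eq_neg_iff_add_eq_0 add.commute)
        hence "inverse c * (c * d) = inverse c * - (a * b)" by simp
        with that(2) show ?thesis by (simp add: field_simps)
      qed
      ultimately have "v = sm (- cx w * inverse (cy w)) u"
        using y by (simp add: vec_eq_iff del: mult_minus_left)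
      hence "v \<in> pt u" by (auto simp: pt_def)
      with uv show False using pt_eqI by metis
    qed
    \<comment> \<open>With \<open>cy w = 0\<close> only the multiple of \<open>u\<close> by
      \<open>cx w\<close> remains, and \<open>u\<close> is nonzero.\<close>
    with w uv show ?thesis by (auto simp: comb_def vec_eq_iff)
  qed
  have "inj ?s"
  proof (rule injI)
    fix x y assume "?s x = ?s y"
    hence "?s (x - y) = 0" using add[of "x - y" y] by simp
    thus "x = y" using ker by fastforce
  qed
  hence bij: "bij ?s" using finite_V by (simp add: bij_def finite_UNIV_inj_surj)
  hence G: "?s \<in> G" by (simp add: G_iff add scale)
  show pt: "?s ` pt w = pt (?s w)" for w
    by (auto simp: pt_def image_image hom)
  have "(`) ?s ` D \<subseteq> D" unfolding D_def using ker by (auto simp: pt intro!: imageI)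
  moreover have "inj_on ((`) ?s) D" using bij by (meson bij_is_inj inj_image_eq_iff inj_onI)
  ultimately have "(`) ?s ` D = D" by (intro endo_inj_surj finite_D)
  with G show "?s \<in> stab_D" by (simp add: stab_D_def)
qed

text \<open>The points 0, infinity and 1 of the projective line, in this order so that fixing the
  first, the first two and all three yields block matrices that are upper triangular, diagonal and
  scalar.\<close>

definition std :: "'v set list" where
  "std = [pt (mk 1 0), pt (mk 0 1), pt (mk 1 1)]"

text \<open>Write \<open>w\<close> as a \<open>K\<close>-combination of \<open>u\<close> and
  \<open>v\<close> and absorb the coefficients into the two vectors, so that \<open>w\<close>
  becomes their sum. The map with these columns sends \<open>mk 1 1\<close> to
  \<open>w\<close>.\<close>

lemma triply_transitive:
  assumes "xs \<in> distinct_lists 3 D"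
  obtains s where "s \<in> stab_D" "map ((`) s) std = xs"
proof -
  obtain A B C where xs: "xs = [A, B, C]"
    using assms by (auto simp: distinct_lists_def numeral_eq_Suc length_Suc_conv)
  have ABC: "A \<in> D" "B \<in> D" "C \<in> D" "A \<noteq> B" "A \<noteq> C" "B \<noteq> C"
    using assms by (auto simp: xs distinct_lists_def)
  obtain u v w where u: "u \<noteq> 0" "A = pt u" and v: "v \<noteq> 0" "B = pt v" and w: "w \<noteq> 0" "C = pt w"
    using ABC by (auto simp: D_def)
  have uv: "pt u \<noteq> pt v" using ABC u v by simp
  have "bij (comb u v)" using comb_in_stab_D[OF u(1) v(1) uv] by (auto simp: stab_D_def G_bij)
  then obtain z where z: "w = comb u v z" by (metis bij_pointE)
  \<comment> \<open>If one of the coefficients vanished, \<open>w\<close> would lie on one of the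
    first two lines.\<close>
  have x: "cx z \<noteq> 0"
  proof
    assume "cx z = 0"
    hence "w = sm (cy z) v" by (auto simp: z comb_def vec_eq_iff)
    hence "w \<in> pt v" by (auto simp: pt_def)
    thus False using w v ABC pt_eqI by metis
  qed
  have y: "cy z \<noteq> 0"
  proof
    assume "cy z = 0"
    hence "w = sm (cx z) u" by (auto simp: z comb_def vec_eq_iff)
    hence "w \<in> pt u" by (auto simp: pt_def)
    thus False using w u ABC pt_eqI by metis
  qed
  let ?u = "sm (cx z) u" and ?v = "sm (cy z) v"
  have u': "?u \<noteq> 0" using x u by (auto simp: vec_eq_iff)
  have v': "?v \<noteq> 0" using y v by (auto simp: vec_eq_iff)
  have "?u \<in> pt u" "?v \<in> pt v" by (auto simp: pt_def)
  hence pts: "pt ?u = A" "pt ?v = B" using pt_eqI u' v' u v by auto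
  have uv': "pt ?u \<noteq> pt ?v" using pts ABC by simp
  have "comb ?u ?v (mk 1 0) = ?u" "comb ?u ?v (mk 0 1) = ?v" "comb ?u ?v (mk 1 1) = w"
    by (auto simp: comb_def vec_eq_iff z)
  hence "map ((`) (comb ?u ?v)) std = xs"
    using comb_pt[OF u' v' uv'] by (simp add: std_def xs pts w)
  with comb_in_stab_D(1)[OF u' v' uv'] that show ?thesis by blast
qed

lemma transitive:
  assumes "m \<le> 3" "xs \<in> distinct_lists m D"
  obtains s where "s \<in> stab_D" "map ((`) s) (take m std) = xs"
proof -
  obtain ys where ys: "ys \<in> distinct_lists 3 D" "take m ys = xs"
    using extend_distinct_list[OF finite_D card_D_ge_3 assms] by blast
  obtain s where "s \<in> stab_D" "map ((`) s) std = ys" using triply_transitive[OF ys(1)] by blast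
  thus ?thesis using that[of s] ys(2) by (metis take_map)
qed

section \<open>Averaging over the group by the number of lines mapped into \<open>D\<close>\<close>

definition meets :: "('v \<Rightarrow> 'v) \<Rightarrow> nat" where
  "meets g = card {W \<in> D. g ` W \<in> D}"

text \<open>The lines counted for \<open>g\<close> correspond under \<open>s\<close> to those
  counted for its conjugate. This makes \<open>1 / (2 * real (meets g))\<close> an admissible weight
  in the sums below.\<close>

lemma meets_stab_D:
  assumes "s \<in> stab_D" "t \<in> stab_D"
  shows "meets (t \<circ> g \<circ> map_inv s) = meets g"
proof -
  have b: "bij s" using assms by (auto simp: stab_D_def intro: G_bij)
  define h where "h = t \<circ> g \<circ> map_inv s"
  have img: "h ` W = t ` g ` map_inv s ` W" for W by (simp add: h_def image_image)
  have "bij_betw ((`) s) {W \<in> D. g ` W \<in> D} {W \<in> D. h ` W \<in> D}"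
    by (rule bij_betwI[of _ _ _ "(`) (map_inv s)"])
      (use b assms stab_D_inv[OF assms(1)] in \<open>auto simp: img stab_D_image\<close>)
  thus ?thesis unfolding meets_def h_def[symmetric] by (rule bij_betw_same_card[symmetric])
qed

definition fixer :: "nat \<Rightarrow> ('v \<Rightarrow> 'v) set" where
  "fixer m = {g \<in> G. map ((`) g) (take m std) = take m std}"

text \<open>If \<open>s\<close> and \<open>t\<close> move the standard tuple to \<open>xs\<close>
  and to \<open>ys\<close>, then g -> t g s^-1 maps \<open>fixer m\<close> bijectively onto the
  elements carrying \<open>xs\<close> to \<open>ys\<close>, and \<open>w\<close> is invariant under
  it.\<close>

lemma sum_transporter:
  fixes w :: "('v \<Rightarrow> 'v) \<Rightarrow> real"
  assumes w: "\<forall>s\<in>stab_D. \<forall>t\<in>stab_D. \<forall>g. w (t \<circ> g \<circ> map_inv s) = w g"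
    and "m \<le> 3" "xs \<in> distinct_lists m D" "ys \<in> distinct_lists m D"
  shows "(\<Sum>g \<in> {g \<in> G. map ((`) g) xs = ys}. w g) = (\<Sum>g\<in>fixer m. w g)"
proof -
  obtain s where s: "s \<in> stab_D" "map ((`) s) (take m std) = xs"
    using transitive[OF assms(2,3)] by blast
  obtain t where t: "t \<in> stab_D" "map ((`) t) (take m std) = ys"
    using transitive[OF assms(2,4)] by blast
  have G: "s \<in> G" "t \<in> G" using s t by (auto simp: stab_D_def)
  have b: "bij s" "bij t" using G by (auto intro: G_bij)
  have st: "map ((`) (map_inv s)) xs = take m std" "map ((`) (map_inv t)) ys = take m std"
    using b by (simp_all add: s(2)[symmetric] t(2)[symmetric] map_idI)
  have cc: "map ((`) (g \<circ> h)) zs = map ((`) g) (map ((`) h) zs)" for g h :: "'v \<Rightarrow> 'v" and zs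
    by (simp add: image_comp)
  show ?thesis
  proof (rule sum.reindex_bij_witness[of _ "\<lambda>g. t \<circ> g \<circ> map_inv s" "\<lambda>g. map_inv t \<circ> g \<circ> s"])
    fix g assume g: "g \<in> {g \<in> G. map ((`) g) xs = ys}"
    show "t \<circ> (map_inv t \<circ> g \<circ> s) \<circ> map_inv s = g" using b
      by (auto simp: fun_eq_iff bij_is_surj surj_f_inv_f)
    show "map_inv t \<circ> g \<circ> s \<in> fixer m"
      unfolding fixer_def using g G by (simp only: cc s(2) st mem_Collect_eq) (auto intro: G_comp G_inv simp: st)
    \<comment> \<open>The invariance is applied to the inverses of \<open>s\<close> and
      \<open>t\<close>, hence the double inverse.\<close>
    have "w (map_inv t \<circ> g \<circ> map_inv (map_inv s)) = w g" using w stab_D_inv[OF s(1)] stab_D_inv[OF t(1)] by blast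
    thus "w (map_inv t \<circ> g \<circ> s) = w g" using b by (simp add: inv_inv_eq)
  next
    fix g assume g: "g \<in> fixer m"
    show "map_inv t \<circ> (t \<circ> g \<circ> map_inv s) \<circ> s = g" using b
      by (auto simp: fun_eq_iff bij_is_inj)
    show "t \<circ> g \<circ> map_inv s \<in> {g \<in> G. map ((`) g) xs = ys}"
      using g G unfolding fixer_def by (simp only: cc t(2) st mem_Collect_eq) (auto intro: G_comp G_inv simp: t)
  qed
qed

text \<open>Double counting: \<open>falling (real (meets g)) m\<close> is the number of
  \<open>m\<close>-tuples of lines whose image is again a tuple of lines of \<open>D\<close>. Each
  pair of a source and a target tuple contributes the same weight, that of
  \<open>fixer m\<close>.\<close>

lemma sum_falling_meets:
  fixes w :: "('v \<Rightarrow> 'v) \<Rightarrow> real"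
  assumes w: "\<forall>s\<in>stab_D. \<forall>t\<in>stab_D. \<forall>g. w (t \<circ> g \<circ> map_inv s) = w g"
    and m: "m \<le> 3"
  shows "(\<Sum>g\<in>G. w g * falling (real (meets g)) m) = (falling (real (card D)) m)\<^sup>2 * (\<Sum>g\<in>fixer m. w g)"
proof -
  let ?D = "distinct_lists m D"
  have fin: "finite ?D" by (rule finite_distinct_lists[OF finite_D])
  have swap: "(\<Sum>g\<in>G. \<Sum>ys\<in>?D. f g ys) = (\<Sum>ys\<in>?D. \<Sum>g\<in>G. f g ys)"
    for f :: "('v \<Rightarrow> 'v) \<Rightarrow> 'v set list \<Rightarrow> real"
    by (rule sum.swap)
  have each: "w g * falling (real (meets g)) m = (\<Sum>xs\<in>?D. \<Sum>ys\<in>?D. if map ((`) g) xs = ys then w g else 0)"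
    if "g \<in> G" for g
  proof -
    have i: "inj ((`) g)" using that by (meson G_bij bij_is_inj inj_image_eq_iff injI)
    have "distinct (map ((`) g) xs) = distinct xs" for xs
      using inj_on_subset[OF i] by (simp add: distinct_map)
    hence "distinct_lists m {W \<in> D. g ` W \<in> D} = {xs \<in> ?D. map ((`) g) xs \<in> ?D}"
      unfolding distinct_lists_def by auto
    hence "falling (real (meets g)) m = real (card {xs \<in> ?D. map ((`) g) xs \<in> ?D})"
      unfolding meets_def by (subst card_distinct_lists[symmetric]) (auto simp: finite_D)
    also have "\<dots> = (\<Sum>xs\<in>?D. if map ((`) g) xs \<in> ?D then 1 else 0)"
      by (simp add: sum.inter_filter[OF fin, symmetric])
    finally have "w g * falling (real (meets g)) m = (\<Sum>xs\<in>?D. w g * (if map ((`) g) xs \<in> ?D then 1 else 0))"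
      by (simp only: sum_distrib_left)
    also have "\<dots> = (\<Sum>xs\<in>?D. if map ((`) g) xs \<in> ?D then w g else 0)"
      by (rule sum.cong) simp_all
    also have "\<dots> = (\<Sum>xs\<in>?D. \<Sum>ys\<in>?D. if map ((`) g) xs = ys then w g else 0)"
      by (rule sum.cong[OF refl]) (simp add: fin)
    finally show ?thesis .
  qed
  have transp: "(\<Sum>g\<in>G. if map ((`) g) xs = ys then w g else 0) = (\<Sum>g\<in>fixer m. w g)"
    if "xs \<in> ?D" "ys \<in> ?D" for xs ys
    unfolding sum.inter_filter[OF finite_G, symmetric] by (rule sum_transporter[OF w m that])
  have "(\<Sum>g\<in>G. w g * falling (real (meets g)) m) =
      (\<Sum>g\<in>G. \<Sum>xs\<in>?D. \<Sum>ys\<in>?D. if map ((`) g) xs = ys then w g else 0)"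
    by (rule sum.cong[OF refl each])
  also have "\<dots> = (\<Sum>xs\<in>?D. \<Sum>g\<in>G. \<Sum>ys\<in>?D. if map ((`) g) xs = ys then w g else 0)"
    by (rule swap)
  also have "\<dots> = (\<Sum>xs\<in>?D. \<Sum>ys\<in>?D. \<Sum>g\<in>G. if map ((`) g) xs = ys then w g else 0)"
    by (simp only: swap)
  also have "\<dots> = (\<Sum>xs\<in>?D. \<Sum>ys\<in>?D. \<Sum>g\<in>fixer m. w g)"
    by (simp cong: sum.cong add: transp)
  also have "\<dots> = (real (card ?D))\<^sup>2 * (\<Sum>g\<in>fixer m. w g)" by (simp add: power2_eq_square)
  finally show ?thesis by (simp add: card_distinct_lists[OF finite_D])
qed

text \<open>Sums the closed form of the indicator over the group, with weight 1 for the first two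
  terms and \<open>1 / (2 * real (meets g))\<close> for the third. Elements with
  \<open>meets g = 0\<close> contribute nothing, since every falling factorial is then 0.\<close>

lemma card_meets_pos:
  "real (card {g \<in> G. meets g > 0}) =
     real (card D) ^ 2 * real (card (fixer 1))
     - 1 / 2 * (real (card D) * (real (card D) - 1)) ^ 2 * real (card (fixer 2))
     + (real (card D) * (real (card D) - 1) * (real (card D) - 2)) ^ 2
       * (\<Sum>g\<in>fixer 3. 1 / (2 * real (meets g)))"
proof -
  have "real (card {g \<in> G. meets g > 0}) = (\<Sum>g\<in>G. if meets g > 0 then 1 else 0)"
    using finite_G by (simp add: sum.If_cases Int_def)
  also have "\<dots> = (\<Sum>g\<in>G. 1 * falling (real (meets g)) 1) - (\<Sum>g\<in>G. 1 * falling (real (meets g)) 2) / 2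
     + (\<Sum>g\<in>G. 1 / (2 * real (meets g)) * falling (real (meets g)) 3)"
    by (simp only: indicator_pos_falling sum.distrib sum_subtractf sum_divide_distrib) simp
  also have "\<dots> = (falling (real (card D)) 1)\<^sup>2 * (\<Sum>g\<in>fixer 1. 1)
     - (falling (real (card D)) 2)\<^sup>2 * (\<Sum>g\<in>fixer 2. 1) / 2
     + (falling (real (card D)) 3)\<^sup>2 * (\<Sum>g\<in>fixer 3. 1 / (2 * real (meets g)))"
    by (subst (1 2 3) sum_falling_meets) (simp_all add: meets_stab_D)
  finally show ?thesis by (simp add: falling_small)
qed

section \<open>A maximal set of disjoint images of \<open>D\<close>\<close>

lemma greedy:
  obtains M where "M \<subseteq> G"
    "\<And>g h. g \<in> M \<Longrightarrow> h \<in> M \<Longrightarrow> g \<noteq> h \<Longrightarrow> disjnt ((`) g ` D) ((`) h ` D)"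
    "card G \<le> card M * card {g \<in> G. meets g > 0}"
proof -
  define ok where "ok M \<longleftrightarrow> M \<subseteq> G \<and> (\<forall>g\<in>M. \<forall>h\<in>M. g \<noteq> h \<longrightarrow> disjnt ((`) g ` D) ((`) h ` D))" for M
  have "finite {M. ok M}"
    by (rule finite_subset[of _ "Pow G"]) (auto simp: ok_def finite_G)
  moreover have "ok {}" by (simp add: ok_def)
  ultimately obtain M where M: "ok M" and max: "\<And>M'. ok M' \<Longrightarrow> M \<subseteq> M' \<Longrightarrow> M' = M"
    using finite_has_maximal[of "{M. ok M}"] by blast
  \<comment> \<open>The elements \<open>g\<close> for which g D and D share a member; unrelated to
    the coordinate \<open>cx\<close>.\<close>
  let ?cx = "{g \<in> G. meets g > 0}"
  have pos: "meets g > 0 \<longleftrightarrow> (\<exists>W\<in>D. g ` W \<in> D)" for g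
    by (auto simp: meets_def card_gt_0_iff finite_D)
  have DD: "D \<noteq> {}" using card_D_ge_3 by auto
  have "G \<subseteq> (\<Union>h\<in>M. (\<circ>) h ` ?cx)"
  proof
    fix g assume g: "g \<in> G"
    \<comment> \<open>Otherwise \<open>g\<close> could be added to \<open>M\<close>; for
      \<open>g\<close> in \<open>M\<close> itself, the nonempty family g D meets itself.\<close>
    have "\<exists>h\<in>M. \<not> disjnt ((`) g ` D) ((`) h ` D)"
    proof (cases "g \<in> M")
      case True
      thus ?thesis using DD by (auto simp: disjnt_def)
    next
      case False
      show ?thesis
      proof (rule ccontr)
        assume "\<not> ?thesis"
        hence "ok (insert g M)" using M g by (auto simp: ok_def disjnt_sym)
        from max[OF this] False show False by blast
      qed
    qed
    then obtain h W W' where h: "h \<in> M" and W: "W \<in> D" "W' \<in> D" "g ` W = h ` W'"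
      by (fastforce simp: disjnt_def)
    have hG: "h \<in> G" using h M by (auto simp: ok_def)
    hence b: "bij h" by (rule G_bij)
    \<comment> \<open>Pulling the common line back by \<open>h\<close> shows that h^-1 g maps
      \<open>W\<close> to \<open>W'\<close>, so \<open>g\<close> lies in the translate of
      \<open>?cx\<close> by \<open>h\<close>.\<close>
    have "(map_inv h \<circ> g) ` W = W'" by (simp only: image_comp[symmetric] W(3) image_inv_image(2)[OF b])
    hence "map_inv h \<circ> g \<in> ?cx" using g hG W by (auto simp: pos G_comp G_inv)
    moreover have "g = h \<circ> (map_inv h \<circ> g)" using b by (auto simp: fun_eq_iff bij_is_surj surj_f_inv_f)
    ultimately show "g \<in> (\<Union>h\<in>M. (\<circ>) h ` ?cx)" using h by blast
  qed
  moreover have finM: "finite M" using M finite_G by (auto simp: ok_def intro: finite_subset)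
  moreover have finX: "finite ?cx" using finite_G by simp
  ultimately have "card G \<le> card (\<Union>h\<in>M. (\<circ>) h ` ?cx)" by (intro card_mono) auto
  also have "\<dots> \<le> (\<Sum>h\<in>M. card ((\<circ>) h ` ?cx))" by (rule card_UN_le[OF finM])
  also have "\<dots> \<le> (\<Sum>h\<in>M. card ?cx)" by (intro sum_mono card_image_le finX)
  finally have "card G \<le> card M * card ?cx" by simp
  with M show ?thesis using that by (auto simp: ok_def)
qed

section \<open>Block matrices over the endomorphisms of \<open>K\<close>\<close>

text \<open>The endomorphisms of \<open>K\<close> that are linear over the small field, taken
  extensional so that equality of maps is equality on \<open>K\<close> and the set is
  finite.\<close>

definition HomK :: "('a \<Rightarrow> 'a) set" where
  "HomK = {\<phi> \<in> extensional K. (\<forall>x\<in>K. \<phi> x \<in> K) \<and> (\<forall>x\<in>K. \<forall>y\<in>K. \<phi> (x + y) = \<phi> x + \<phi> y) \<and>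
     (\<forall>c. \<forall>x\<in>K. \<phi> (emb c * x) = emb c * \<phi> x)}"

definition GLK :: "('a \<Rightarrow> 'a) set" where
  "GLK = {\<phi> \<in> HomK. bij_betw \<phi> K K}"

text \<open>Identifying \<open>a \<in> K\<close> with multiplication by \<open>a\<close>, this is \<open>K \<inter> \<phi>\<^sup>-\<^sup>1 K \<phi>\<close>.\<close>
definition normalized_part :: "('a \<Rightarrow> 'a) \<Rightarrow> 'a set" where
  "normalized_part \<phi> = {a \<in> K. \<exists>b\<in>K. \<forall>x\<in>K. \<phi> (a * x) = b * \<phi> x}"

lemma finite_HomK: "finite HomK"
proof -
  have "HomK \<subseteq> K \<rightarrow>\<^sub>E K" by (auto simp: HomK_def PiE_def)
  thus ?thesis by (rule finite_subset) (intro finite_PiE finite_K)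
qed

lemma finite_GLK: "finite GLK"
  using finite_HomK by (simp add: GLK_def)

lemma additive_bij_betw:
  assumes "\<And>x. x \<in> K \<Longrightarrow> f x \<in> K" "\<And>x y. x \<in> K \<Longrightarrow> y \<in> K \<Longrightarrow> f (x + y) = f x + (f y :: 'a)"
    and ker: "\<And>x. x \<in> K \<Longrightarrow> f x = 0 \<Longrightarrow> x = 0"
  shows "bij_betw f K K"
proof -
  have "inj_on f K"
  proof (rule inj_onI)
    fix x y assume xy: "x \<in> K" "y \<in> K" "f x = f y"
    have "f (x + - y + y) = f (x + - y) + f y" using xy by (intro assms K_add K_uminus)
    hence "f (x + - y) = 0" using xy by simp
    hence "x + - y = 0" using ker xy K_add K_uminus by blast
    thus "x = y" by simp
  qed
  thus ?thesis using assms(1) finite_K by (simp add: bij_betw_def endo_inj_surj image_subset_iff)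
qed

lemma mk_add: "x \<in> K \<Longrightarrow> y \<in> K \<Longrightarrow> x' \<in> K \<Longrightarrow> y' \<in> K \<Longrightarrow> mk (x + x') (y + y') = mk x y + mk x' y'"
  by (simp add: vec_eq_iff)

lemma mk_scale: "x \<in> K \<Longrightarrow> y \<in> K \<Longrightarrow> mk (emb c * x) (emb c * y) = scale c (mk x y)"
  by (simp add: vec_eq_iff)

lemma G_add: "g \<in> G \<Longrightarrow> g (u + v) = g u + g v"
  and G_scale: "g \<in> G \<Longrightarrow> g (scale c v) = scale c (g v)"
  by (simp_all add: G_iff)

lemma G_eq_0_iff: "g \<in> G \<Longrightarrow> g v = 0 \<longleftrightarrow> v = 0"
  using G_0 G_bij by (metis bij_pointE)

text \<open>These are the four blocks of \<open>g\<close> as a 2 x 2 matrix; by additivity they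
  determine \<open>g\<close>.\<close>

lemma G_blocks:
  assumes "g \<in> G"
  shows "(\<lambda>x\<in>K. cx (g (mk x 0))) \<in> HomK" "(\<lambda>y\<in>K. cx (g (mk 0 y))) \<in> HomK"
    "(\<lambda>x\<in>K. cy (g (mk x 0))) \<in> HomK" "(\<lambda>y\<in>K. cy (g (mk 0 y))) \<in> HomK"
proof -
  have add: "mk (x + x') 0 = mk x 0 + mk x' 0" "mk 0 (x + x') = mk 0 x + mk 0 x'"
    if "x \<in> K" "x' \<in> K" for x x'
    using that mk_add[of x 0 x' 0] mk_add[of 0 x 0 x'] by simp_all
  have hom: "mk (emb c * x) 0 = scale c (mk x 0)" "mk 0 (emb c * x) = scale c (mk 0 x)"
    if "x \<in> K" for c x
    using that mk_scale[of x 0] mk_scale[of 0 x] by simp_all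
  show "(\<lambda>x\<in>K. cx (g (mk x 0))) \<in> HomK" "(\<lambda>y\<in>K. cx (g (mk 0 y))) \<in> HomK"
    "(\<lambda>x\<in>K. cy (g (mk x 0))) \<in> HomK" "(\<lambda>y\<in>K. cy (g (mk 0 y))) \<in> HomK"
    unfolding HomK_def using assms by (simp_all add: add hom G_add G_scale)
qed

lemma G_decompose: "g \<in> G \<Longrightarrow> g v = g (mk (cx v) 0) + g (mk 0 (cy v))"
  using mk_add[of "cx v" 0 0 "cy v"] by (simp flip: G_add)

lemma GLK_I:
  assumes "\<phi> \<in> HomK" "\<And>x. x \<in> K \<Longrightarrow> \<phi> x = 0 \<Longrightarrow> x = 0"
  shows "\<phi> \<in> GLK"
proof -
  have "bij_betw \<phi> K K" by (rule additive_bij_betw) (use assms in \<open>auto simp: HomK_def\<close>)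
  thus ?thesis using assms by (simp add: GLK_def)
qed

section \<open>Pointwise stabilizers of one, two and three standard lines\<close>

lemma fixer_iff:
  "g \<in> fixer 1 \<longleftrightarrow> g \<in> G \<and> g ` pt (mk 1 0) = pt (mk 1 0)"
  "g \<in> fixer 2 \<longleftrightarrow> g \<in> fixer 1 \<and> g ` pt (mk 0 1) = pt (mk 0 1)"
  "g \<in> fixer 3 \<longleftrightarrow> g \<in> fixer 2 \<and> g ` pt (mk 1 1) = pt (mk 1 1)"
  "g \<in> fixer (Suc 0) \<longleftrightarrow> g \<in> G \<and> g ` pt (mk 1 0) = pt (mk 1 0)"
  by (auto simp: fixer_def std_def numeral_eq_Suc)

lemma mem_pt_zero: "v \<in> pt (mk 1 0) \<longleftrightarrow> cy v = 0"
  by (simp add: mem_pt_slope)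

text \<open>The first standard line has the equation y = 0; \<open>g\<close> maps it onto itself,
  and injectivity keeps the images of all other vectors off it.\<close>

lemma fixer_1_iff:
  assumes g: "g \<in> fixer 1"
  shows "cy (g v) = 0 \<longleftrightarrow> cy v = 0"
proof -
  have G: "g \<in> G" and im: "g ` pt (mk 1 0) = pt (mk 1 0)" using g by (auto simp: fixer_iff)
  have "inj g" using G by (simp add: G_bij bij_is_inj)
  hence "g v \<in> g ` pt (mk 1 0) \<longleftrightarrow> v \<in> pt (mk 1 0)" by (rule inj_image_mem_iff)
  thus ?thesis unfolding im by (simp add: mem_pt_zero)
qed

lemma fixer_2_iff:
  assumes g: "g \<in> fixer 2"
  shows "cx (g v) = 0 \<longleftrightarrow> cx v = 0"
proof -
  have G: "g \<in> G" and im: "g ` pt (mk 0 1) = pt (mk 0 1)" using g by (auto simp: fixer_iff)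
  have "inj g" using G by (simp add: G_bij bij_is_inj)
  hence "g v \<in> g ` pt (mk 0 1) \<longleftrightarrow> v \<in> pt (mk 0 1)" by (rule inj_image_mem_iff)
  thus ?thesis unfolding im by (simp add: mem_pt_infinity)
qed

text \<open>As the lower left block vanishes, a nonzero kernel vector of a diagonal block would give
  a nonzero vector killed by \<open>g\<close>, or one outside the first line that is mapped into
  it.\<close>

lemma fixer_1_blocks:
  assumes g: "g \<in> fixer 1"
  shows "(\<lambda>x\<in>K. cx (g (mk x 0))) \<in> GLK" "(\<lambda>y\<in>K. cy (g (mk 0 y))) \<in> GLK"
proof -
  have G: "g \<in> G" using g by (simp add: fixer_iff)
  show "(\<lambda>x\<in>K. cx (g (mk x 0))) \<in> GLK"
  proof (rule GLK_I[OF G_blocks(1)[OF G]])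
    fix x assume x: "x \<in> K" "(\<lambda>x\<in>K. cx (g (mk x 0))) x = 0"
    have "cy (g (mk x 0)) = 0" using fixer_1_iff[OF g] x by simp
    hence "g (mk x 0) = 0" using x by (simp add: vec_eq_iff)
    hence "mk x 0 = 0" using G_eq_0_iff[OF G] by blast
    thus "x = 0" using x by (simp add: vec_eq_iff)
  qed
  show "(\<lambda>y\<in>K. cy (g (mk 0 y))) \<in> GLK"
    by (rule GLK_I[OF G_blocks(4)[OF G]]) (use fixer_1_iff[OF g] in simp)
qed

text \<open>A block upper triangular matrix is determined by its diagonal blocks, in
  \<open>GLK\<close>, and its upper right block, in \<open>HomK\<close>. An upper bound is the right
  direction because this count enters with a positive sign.\<close>

lemma card_fixer_1: "card (fixer 1) \<le> card GLK ^ 2 * card HomK"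
proof -
  let ?f = "\<lambda>g. ((\<lambda>x\<in>K. cx (g (mk x 0))), (\<lambda>y\<in>K. cx (g (mk 0 y))), (\<lambda>y\<in>K. cy (g (mk 0 y))))"
  have "inj_on ?f (fixer 1)"
  proof (rule inj_onI)
    fix g h assume gh: "g \<in> fixer 1" "h \<in> fixer 1" and eq: "?f g = ?f h"
    have "cx (g (mk x 0)) = cx (h (mk x 0))" "cx (g (mk 0 x)) = cx (h (mk 0 x))"
      "cy (g (mk 0 x)) = cy (h (mk 0 x))" if "x \<in> K" for x
      using eq that by (auto dest!: fun_cong[of _ _ x])
    moreover have "cy (g (mk x 0)) = 0" "cy (h (mk x 0)) = 0" if "x \<in> K" for x
      using fixer_1_iff gh that by simp_all
    ultimately have "g (mk x 0) = h (mk x 0)" "g (mk 0 x) = h (mk 0 x)" if "x \<in> K" for x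
      using that by (simp_all add: vec_eq_iff)
    thus "g = h" using G_decompose gh by (metis cx_K cy_K ext fixer_iff(1))
  qed
  moreover have "?f ` fixer 1 \<subseteq> GLK \<times> HomK \<times> GLK"
  proof (rule image_subsetI)
    fix g assume g: "g \<in> fixer 1"
    hence "g \<in> G" by (simp add: fixer_iff)
    thus "?f g \<in> GLK \<times> HomK \<times> GLK" using fixer_1_blocks[OF g] G_blocks(2) by simp
  qed
  ultimately have "card (fixer 1) \<le> card (GLK \<times> HomK \<times> GLK)"
    by (rule card_inj_on_le) (auto simp: finite_GLK finite_HomK)
  thus ?thesis by (simp add: card_cartesian_product power2_eq_square mult_ac)
qed

lemma GLK_D:
  assumes "\<phi> \<in> GLK"
  shows "x \<in> K \<Longrightarrow> \<phi> x \<in> K" "x \<in> K \<Longrightarrow> y \<in> K \<Longrightarrow> \<phi> (x + y) = \<phi> x + \<phi> y"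
    "x \<in> K \<Longrightarrow> \<phi> (emb c * x) = emb c * \<phi> x" "bij_betw \<phi> K K"
  using assms by (auto simp: GLK_def HomK_def)

lemma GLK_eq_0_iff:
  assumes "\<phi> \<in> GLK" "x \<in> K"
  shows "\<phi> x = 0 \<longleftrightarrow> x = 0"
proof -
  have "\<phi> 0 + \<phi> 0 = \<phi> 0" using GLK_D(2)[OF assms(1), of 0 0] unfolding add_0 by (simp only: K_0)
  hence "\<phi> 0 = 0" by (simp only: add_cancel_right_right add_cancel_left_left)
  thus ?thesis using GLK_D(4)[OF assms(1)] assms(2) by (metis K_0 bij_betw_inv_into_left)
qed

definition diag :: "('a \<Rightarrow> 'a) \<Rightarrow> ('a \<Rightarrow> 'a) \<Rightarrow> 'v \<Rightarrow> 'v" where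
  "diag \<phi> \<psi> v = mk (\<phi> (cx v)) (\<psi> (cy v))"

lemma diag_in_fixer_2:
  assumes "\<phi> \<in> GLK" "\<psi> \<in> GLK"
  shows "diag \<phi> \<psi> \<in> fixer 2"
proof -
  note D = GLK_D[OF assms(1)] GLK_D[OF assms(2)]
  let ?g = "diag \<phi> \<psi>"
  have c [simp]: "cx (?g v) = \<phi> (cx v)" "cy (?g v) = \<psi> (cy v)" for v
    by (simp_all add: diag_def D)
  have add: "?g (u + v) = ?g u + ?g v" for u v by (simp add: vec_eq_iff D)
  have scale: "?g (scale d v) = scale d (?g v)" for d v by (simp add: vec_eq_iff D)
  have "inj ?g"
  proof (rule injI)
    fix u v assume "?g u = ?g v"
    hence "\<phi> (cx u) = \<phi> (cx v)" "\<psi> (cy u) = \<psi> (cy v)" by (simp_all add: vec_eq_iff)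
    hence "cx u = cx v" "cy u = cy v" using D(4,8) by (metis bij_betw_inv_into_left cx_K cy_K)+
    thus "u = v" by (rule vec_eqI)
  qed
  hence bij: "bij ?g" using finite_V by (simp add: bij_def finite_UNIV_inj_surj)
  hence G: "?g \<in> G" by (simp add: G_iff add scale)
  have iff: "?g v \<in> W \<longleftrightarrow> v \<in> W" if "W = pt (mk 1 0) \<or> W = pt (mk 0 1)" for v W
    using that GLK_eq_0_iff[OF assms(1)] GLK_eq_0_iff[OF assms(2)]
    by (auto simp: mem_pt_zero mem_pt_infinity)
  have "?g ` W = W" if "W = pt (mk 1 0) \<or> W = pt (mk 0 1)" for W
  proof
    show "?g ` W \<subseteq> W" using iff[OF that] by blast
    show "W \<subseteq> ?g ` W"
    proof
      fix w assume "w \<in> W"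
      moreover obtain v where "w = ?g v" using bij by (metis bij_pointE)
      ultimately show "w \<in> ?g ` W" using iff[OF that] by blast
    qed
  qed
  thus ?thesis using G by (simp add: fixer_iff)
qed

text \<open>Block diagonal matrices with invertible blocks are distinct members of
  \<open>fixer 2\<close>. This count enters with a negative sign, hence the lower bound.\<close>

lemma card_fixer_2: "card GLK ^ 2 \<le> card (fixer 2)"
proof -
  have "inj_on (\<lambda>(\<phi>, \<psi>). diag \<phi> \<psi>) (GLK \<times> GLK)"
  proof (rule inj_onI, clarify)
    fix \<phi> \<psi> \<phi>' \<psi>' assume m: "\<phi> \<in> GLK" "\<psi> \<in> GLK" "\<phi>' \<in> GLK" "\<psi>' \<in> GLK" and eq: "diag \<phi> \<psi> = diag \<phi>' \<psi>'"
    have "\<phi> x = \<phi>' x \<and> \<psi> x = \<psi>' x" if "x \<in> K" for x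
      \<comment> \<open>The vector \<open>mk x x\<close> compares both blocks at \<open>x\<close> at
        once.\<close>
      using fun_cong[OF eq, of "mk x x"] m that by (auto simp: diag_def vec_eq_iff GLK_D)
    moreover have "\<phi> \<in> extensional K" "\<psi> \<in> extensional K" "\<phi>' \<in> extensional K" "\<psi>' \<in> extensional K"
      using m by (auto simp: GLK_def HomK_def)
    ultimately show "\<phi> = \<phi>' \<and> \<psi> = \<psi>'" by (auto intro: extensionalityI)
  qed
  moreover have "(\<lambda>(\<phi>, \<psi>). diag \<phi> \<psi>) ` (GLK \<times> GLK) \<subseteq> fixer 2" by (auto simp: diag_in_fixer_2)
  moreover have "finite (fixer 2)" unfolding fixer_def using finite_G by simp
  ultimately have "card (GLK \<times> GLK) \<le> card (fixer 2)" by (rule card_inj_on_le)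
  thus ?thesis by (simp add: card_cartesian_product power2_eq_square)
qed

text \<open>The off-diagonal blocks vanish, and preserving the line y = x makes the two diagonal
  blocks equal.\<close>

lemma fixer_3_coords:
  assumes g: "g \<in> fixer 3"
  defines "\<phi> \<equiv> \<lambda>x\<in>K. cx (g (mk x 0))"
  shows "cx (g v) = \<phi> (cx v)" "cy (g v) = \<phi> (cy v)"
proof -
  have G: "g \<in> G" and g1: "g \<in> fixer 1" and g2: "g \<in> fixer 2" and im: "g ` pt (mk 1 1) = pt (mk 1 1)"
    using g by (auto simp: fixer_iff)
  have z: "cy (g (mk x 0)) = 0" "cx (g (mk 0 x)) = 0" if "x \<in> K" for x
    using that fixer_1_iff[OF g1] fixer_2_iff[OF g2] by simp_all
  have y: "cy (g (mk 0 x)) = cx (g (mk x 0))" if x: "x \<in> K" for x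
  proof -
    have "mk x x \<in> pt (mk 1 1)" using x by (simp add: mem_pt_slope)
    hence "g (mk x x) \<in> pt (mk 1 1)" using im by blast
    hence "cy (g (mk x x)) = cx (g (mk x x))" by (simp add: mem_pt_slope)
    thus ?thesis using G_decompose[OF G, of "mk x x"] x by (simp add: z)
  qed
  show "cx (g v) = \<phi> (cx v)" "cy (g v) = \<phi> (cy v)"
    using G_decompose[OF G, of v] by (simp_all add: \<phi>_def z y)
qed

text \<open>If \<phi> turns multiplication by \<open>a\<close> into multiplication by
  \<open>b\<close>, then \<open>g\<close> maps the line of slope \<open>a\<close> to the line of
  slope \<open>b\<close>. The additional 1 is the line at infinity. A lower bound suffices since
  \<open>meets g\<close> will stand in a denominator.\<close>

lemma meets_fixer_3:
  assumes g: "g \<in> fixer 3"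
  shows "card (normalized_part (\<lambda>x\<in>K. cx (g (mk x 0)))) + 1 \<le> meets g"
proof -
  define \<phi> where "\<phi> = (\<lambda>x\<in>K. cx (g (mk x 0)))"
  note c = fixer_3_coords[OF g, folded \<phi>_def]
  have "g \<in> fixer 1" using g by (simp add: fixer_iff)
  hence \<phi>: "\<phi> \<in> GLK" unfolding \<phi>_def by (rule fixer_1_blocks)
  let ?A = "normalized_part \<phi>"
  have A: "?A \<subseteq> K" by (auto simp: normalized_part_def)
  have slope: "g ` pt (mk 1 a) \<in> D" if "a \<in> ?A" for a
  proof -
    from that obtain b where a: "a \<in> K" and b: "b \<in> K" "\<And>x. x \<in> K \<Longrightarrow> \<phi> (a * x) = b * \<phi> x"
      by (auto simp: normalized_part_def)
    have "g ` pt (mk 1 a) = pt (mk 1 b)"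
    proof
      show "g ` pt (mk 1 a) \<subseteq> pt (mk 1 b)" using a b by (auto simp: mem_pt_slope c)
      show "pt (mk 1 b) \<subseteq> g ` pt (mk 1 a)"
      proof
        fix w assume "w \<in> pt (mk 1 b)"
        hence w: "cy w = b * cx w" using b by (simp add: mem_pt_slope)
        obtain x where x: "x \<in> K" "\<phi> x = cx w"
          using GLK_D(4)[OF \<phi>] cx_K[of w] by (metis bij_betw_def imageE)
        \<comment> \<open>The preimage of \<open>w\<close> is the point of the line of slope
          \<open>a\<close> whose first coordinate is taken by \<phi> to \<open>cx w\<close>.\<close>
        have "w = g (mk x (a * x))" using x a b w by (simp add: vec_eq_iff c)
        moreover have "mk x (a * x) \<in> pt (mk 1 a)" using x a by (simp add: mem_pt_slope)
        ultimately show "w \<in> g ` pt (mk 1 a)" by blast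
      qed
    qed
    thus ?thesis using b by (simp add: pt_in_D)
  qed
  have inf: "g ` pt (mk 0 1) \<in> D" using g pt_in_D by (simp add: fixer_iff)
  have "insert (pt (mk 0 1)) ((\<lambda>a. pt (mk 1 a)) ` ?A) \<subseteq> {W \<in> D. g ` W \<in> D}"
    using slope inf A by (auto intro!: pt_in_D)
  hence "card (insert (pt (mk 0 1)) ((\<lambda>a. pt (mk 1 a)) ` ?A)) \<le> meets g"
    unfolding meets_def by (rule card_mono[rotated]) (simp add: finite_D)
  moreover have "card (insert (pt (mk 0 1)) ((\<lambda>a. pt (mk 1 a)) ` ?A)) = card ?A + 1"
    using infinity_not_slope A finite_subset[OF A finite_K] card_image[OF inj_on_subset[OF inj_slope A]]
    by (subst card_insert_disjoint) auto
  ultimately show ?thesis by (simp add: \<phi>_def)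
qed

text \<open>Each member of \<open>fixer 3\<close> is determined by its diagonal block in
  \<open>GLK\<close>; passing to all of \<open>GLK\<close> only adds nonnegative terms.\<close>

lemma sum_fixer_3:
  "(\<Sum>g\<in>fixer 3. 1 / (2 * real (meets g))) \<le> (\<Sum>\<phi>\<in>GLK. 1 / (2 * (real (card (normalized_part \<phi>)) + 1)))"
proof -
  define f where "f = (\<lambda>g. \<lambda>x\<in>K. cx (g (mk x 0)))"
  have inj: "inj_on f (fixer 3)"
  proof (rule inj_onI)
    fix g h assume gh: "g \<in> fixer 3" "h \<in> fixer 3" "f g = f h"
    have "g v = h v" for v
      using fixer_3_coords[OF gh(1), of v] fixer_3_coords[OF gh(2), of v] gh(3)
      unfolding f_def by (intro vec_eqI) simp_all
    thus "g = h" by blast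
  qed
  have img: "f ` fixer 3 \<subseteq> GLK" using fixer_1_blocks(1) by (auto simp: f_def fixer_iff(2,3))
  have "(\<Sum>g\<in>fixer 3. 1 / (2 * real (meets g))) \<le>
      (\<Sum>g\<in>fixer 3. 1 / (2 * (real (card (normalized_part (f g))) + 1)))"
  proof (rule sum_mono)
    fix g assume "g \<in> fixer 3"
    hence "real (card (normalized_part (f g))) + 1 \<le> real (meets g)"
      using meets_fixer_3[of g] by (simp add: f_def)
    thus "1 / (2 * real (meets g)) \<le> 1 / (2 * (real (card (normalized_part (f g))) + 1))"
      by (intro divide_left_mono) auto
  qed
  also have "\<dots> = (\<Sum>\<phi>\<in>f ` fixer 3. 1 / (2 * (real (card (normalized_part \<phi>)) + 1)))"
    by (simp only: sum.reindex[OF inj] o_def)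
  also have "\<dots> \<le> (\<Sum>\<phi>\<in>GLK. 1 / (2 * (real (card (normalized_part \<phi>)) + 1)))"
    by (rule sum_mono2[OF finite_GLK img]) simp
  finally show ?thesis .
qed

text \<open>Each stabilizer count is estimated in the direction that the sign of its term
  demands.\<close>

lemma card_meets_pos_le:
  "real (card {g \<in> G. meets g > 0}) \<le>
     real (card D) ^ 2 * (real (card HomK) * real (card GLK) ^ 2)
     - 1 / 2 * (real (card D) * (real (card D) - 1)) ^ 2 * real (card GLK) ^ 2
     + (real (card D) * (real (card D) - 1) * (real (card D) - 2)) ^ 2
       * (\<Sum>\<phi>\<in>GLK. 1 / (2 * (real (card (normalized_part \<phi>)) + 1)))"
proof -
  have "real (card (fixer 1)) \<le> real (card HomK) * real (card GLK) ^ 2"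
    using card_fixer_1 by (metis mult.commute of_nat_le_iff of_nat_mult of_nat_power)
  moreover have "real (card GLK) ^ 2 \<le> real (card (fixer 2))"
    using card_fixer_2 by (metis of_nat_le_iff of_nat_power)
  ultimately show ?thesis
    unfolding card_meets_pos
    by (intro add_mono diff_mono mult_left_mono sum_fixer_3) simp_all
qed

section \<open>Images of \<open>D\<close> as spreads\<close>

text \<open>Closure properties pass from \<open>pt u\<close> to its image by linearity; the
  cardinality is recorded because it determines the dimension.\<close>

lemma subspace_image_D:
  assumes "g \<in> G" "W \<in> (`) g ` D"
  shows "module.subspace scale W" and card_image_D: "card W = card K"
proof -
  interpret vector_space scale by (rule vs)
  obtain u where u: "u \<noteq> 0" "W = g ` pt u" using assms(2) by (auto simp: D_def)
  have 0: "g 0 = 0" using assms(1) by (rule G_0)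
  have sub: "0 \<in> pt u" "v \<in> pt u \<Longrightarrow> w \<in> pt u \<Longrightarrow> v + w \<in> pt u" "v \<in> pt u \<Longrightarrow> scale c v \<in> pt u" for v w c
  proof -
    have "0 = sm 0 u" by (simp add: vec_eq_iff)
    thus "0 \<in> pt u" by (auto simp: pt_def)
    have "sm a u + sm b u = sm (a + b) u" if "a \<in> K" "b \<in> K" for a b
      using that by (simp add: vec_eq_iff algebra_simps)
    thus "v \<in> pt u \<Longrightarrow> w \<in> pt u \<Longrightarrow> v + w \<in> pt u" by (auto simp: pt_def)
    have "scale c (sm a u) = sm (emb c * a) u" if "a \<in> K" for a
      using that by (simp add: vec_eq_iff mult.assoc)
    thus "v \<in> pt u \<Longrightarrow> scale c v \<in> pt u" by (auto simp: pt_def)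
  qed
  show "subspace W"
    unfolding subspace_def u
  proof (intro conjI ballI allI)
    show "0 \<in> g ` pt u" using imageI[OF sub(1), of g] by (simp only: 0)
    fix x assume "x \<in> g ` pt u"
    then obtain v where v: "v \<in> pt u" "x = g v" by blast
    show "scale c x \<in> g ` pt u" for c using imageI[OF sub(3)[OF v(1)], of g c] by (simp only: v(2) G_scale[OF assms(1)])
    fix y assume "y \<in> g ` pt u"
    then obtain w where w: "w \<in> pt u" "y = g w" by blast
    show "x + y \<in> g ` pt u" using imageI[OF sub(2)[OF v(1) w(1)], of g] by (simp only: v(2) w(2) G_add[OF assms(1)])
  qed
  have "inj_on (\<lambda>c. sm c u) K"
  proof (rule inj_onI)
    fix a b assume ab: "a \<in> K" "b \<in> K" "sm a u = sm b u"
    hence "a * cx u = b * cx u" "a * cy u = b * cy u" by (simp_all add: vec_eq_iff)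
    moreover have "cx u \<noteq> 0 \<or> cy u \<noteq> 0" using u(1) by (simp add: vec_eq_iff)
    ultimately show "a = b" by auto
  qed
  moreover have "inj g" using assms(1) by (simp add: G_bij bij_is_inj)
  then have "inj_on g (pt u)" by (rule inj_on_subset) simp
  ultimately show "card W = card K"
    unfolding u(2) by (metis card_image pt_def)
qed

lemma ex1_image_D:
  assumes "g \<in> G" "v \<noteq> 0"
  shows "\<exists>!W. W \<in> (`) g ` D \<and> v \<in> W"
proof -
  have b: "bij g" using assms by (simp add: G_bij)
  obtain w where w: "v = g w" using b by (metis bij_pointE)
  have "w \<noteq> 0" using assms w G_0 by blast
  then obtain W where W: "W \<in> D" "w \<in> W" "\<And>W'. W' \<in> D \<Longrightarrow> w \<in> W' \<Longrightarrow> W' = W"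
    using ex1_D[of w] by blast
  have "w \<in> W'" if "g w \<in> g ` W'" for W' using that b by (meson bij_is_inj inj_image_mem_iff)
  note mem = this
  show ?thesis
  proof (rule ex1I[of _ "g ` W"])
    show "g ` W \<in> (`) g ` D \<and> v \<in> g ` W" using W(1,2) w by simp
    fix Z assume "Z \<in> (`) g ` D \<and> v \<in> Z"
    then obtain W' where W': "W' \<in> D" "Z = g ` W'" "g w \<in> g ` W'" using w by auto
    from W(3)[OF W'(1) mem[OF W'(3)]] W'(2) show "Z = g ` W" by simp
  qed
qed

end

subsection \<open>Semilinear maps and the counting bound\<close>

text \<open>With \<open>n = Q + 1\<close>, the falling factorial in each term is [n]_i / [n]_3, so
  the summand is a signed binomial coefficient divided by -[n]_3. The full alternating sum of
  binomial coefficients vanishes, which leaves the terms with \<open>i \<le> 3\<close> to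
  evaluate.\<close>

lemma alternating_falling_sum:
  assumes "2 \<le> Q" "Q + 1 \<le> N"
  shows "(\<Sum>i = 4..N. (-1) ^ (i + 1) / fact i * falling (real Q - 2) (i - 3)) = 1 / (2 * (real Q + 1)) - 1 / 6"
proof -
  define n where "n = Q + 1"
  have n: "3 \<le> n" "n \<le> N" using assms by (auto simp: n_def)
  define P where "P = real n * (real n - 1) * (real n - 2)"
  have P: "P \<noteq> 0" using n by (auto simp: P_def)
  have "real (n choose i) = P * falling (real Q - 2) (i - 3) / fact i" if "4 \<le> i" for i
  proof -
    define j where "j = i - 3"
    have i: "i = Suc (Suc (Suc j))" using that by (simp add: j_def)
    have "real (n choose i) = falling (real n) i / fact i"
      unfolding binomial_gbinomial gbinomial_prod_rev falling_def by (simp add: atLeast0LessThan)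
    also have "falling (real n) i = P * falling (real Q - 2) (i - 3)"
      unfolding i falling_def P_def n_def by (simp add: prod.lessThan_Suc_shift algebra_simps del: prod.lessThan_Suc)
    finally show ?thesis .
  qed
  hence summand: "(-1) ^ (i + 1) / fact i * falling (real Q - 2) (i - 3) = - ((-1) ^ i * real (n choose i)) / P"
    if "4 \<le> i" for i
    using that P by simp
  \<comment> \<open>Binomial coefficients with \<open>i\<close> above \<open>n\<close> are 0, so the
    sum may stop at \<open>n\<close>.\<close>
  have "(\<Sum>i\<le>N. (-1) ^ i * real (n choose i)) = (\<Sum>i\<le>n. (-1) ^ i * real (n choose i))"
    using n by (intro sum.mono_neutral_right) auto
  also have "\<dots> = 0" using choose_alternating_sum[of n, where 'a = real] n by simp
  finally have "(\<Sum>i\<le>N. (-1) ^ i * real (n choose i)) = 0" .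
  moreover have "{..N} = {0, 1, 2, 3} \<union> {4..N}" using n by auto
  ultimately have "0 = (\<Sum>i\<in>{0, 1, 2, 3} \<union> {4..N}. (-1) ^ i * real (n choose i))" by simp
  also have "\<dots> = 1 - real n + real (n choose 2) - real (n choose 3) + (\<Sum>i = 4..N. (-1) ^ i * real (n choose i))"
    by (subst sum.union_disjoint) auto
  also have "real (n choose 2) = real n * (real n - 1) / 2"
    unfolding binomial_gbinomial gbinomial_prod_rev by (simp add: numeral_eq_Suc)
  also have "real (n choose 3) = P / 6"
    unfolding binomial_gbinomial gbinomial_prod_rev P_def by (simp add: numeral_eq_Suc algebra_simps)
  finally have s: "(\<Sum>i = 4..N. (-1) ^ i * real (n choose i)) = P / 6 - (real n - 1) * (real n - 2) / 2"
    by (simp add: field_simps)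
  have "(\<Sum>i = 4..N. (-1) ^ (i + 1) / fact i * falling (real Q - 2) (i - 3)) =
      (\<Sum>i = 4..N. - ((-1) ^ i * real (n choose i)) / P)"
    by (intro sum.cong refl summand) simp
  also have "\<dots> = - (P / 6 - (real n - 1) * (real n - 2) / 2) / P"
    unfolding s[symmetric] by (simp add: sum_negf sum_divide_distrib)
  also have "\<dots> = (real n - 1) * (real n - 2) / (2 * P) - 1 / 6" using P by (simp add: field_simps)
  also have "(real n - 1) * (real n - 2) / (2 * P) = 1 / (2 * real n)" using n by (simp add: P_def)
  finally show ?thesis by (simp add: n_def)
qed

section \<open>Choice of coordinates\<close>

text \<open>The square of \<open>GF k\<close> has q^(2k) elements, hence dimension 2k over the small
  field, and spaces of equal finite dimension are isomorphic. The coordinates are the components of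
  such an isomorphism.\<close>

lemma ex_coordinates:
  fixes scale :: "'f::{field,finite} \<Rightarrow> 'v::ab_group_add \<Rightarrow> 'v"
  assumes k: "k > 0" and vs: "vector_space scale" and dim: "vector_space.dim scale (UNIV :: 'v set) = 2 * k"
  obtains cx cy :: "'v \<Rightarrow> 'f alg_closure" and mk
  where "coordinatized_space (GF k) to_ac scale cx cy mk"
proof -
  let ?E = "GF k \<times> GF k :: ('f alg_closure \<times> 'f alg_closure) set"
  define scale2 :: "'f \<Rightarrow> 'f alg_closure \<times> 'f alg_closure \<Rightarrow> 'f alg_closure \<times> 'f alg_closure"
    where "scale2 c p = (to_ac c * fst p, to_ac c * snd p)" for c p
  have vs2: "vector_space scale2"
    by unfold_locales (auto simp: scale2_def algebra_simps)
  interpret P: vector_space_pair scale scale2 using vs vs2 by (simp add: vector_space_pair_def)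
  have "GF 1 \<subseteq> (GF k :: 'f alg_closure set)" by (rule GF_mono) simp
  hence to_ac: "to_ac c \<in> (GF k :: 'f alg_closure set)" for c unfolding GF_base by blast
  have sub: "P.vs2.subspace ?E"
    unfolding P.vs2.subspace_def by (auto simp: scale2_def zero_prod_def to_ac)
  have finE: "finite ?E" by (intro finite_SigmaI finite_GF k)
  have "CARD('f) ^ P.vs2.dim ?E = CARD('f) ^ (2 * k)"
    using card_subspace[OF vs2 sub finE] card_GF[OF k, where 'f = 'f]
    by (simp add: card_cartesian_product mult_2 power_add)
  hence dimE: "P.vs2.dim ?E = 2 * k" using CARD_field_gt_1[where 'f = 'f] by simp
  obtain B :: "'v set" where B: "B \<subseteq> UNIV" "P.vs1.independent B" "UNIV \<subseteq> P.vs1.span B" "card B = P.vs1.dim (UNIV :: 'v set)"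
    using P.vs1.basis_exists by blast
  have finB: "finite B" using B(4) dim k by (intro card_ge_0_finite) simp
  obtain C where C: "C \<subseteq> ?E" "P.vs2.independent C" "?E \<subseteq> P.vs2.span C" "card C = P.vs2.dim ?E"
    using P.vs2.basis_exists by blast
  obtain f where f: "Vector_Spaces.linear scale scale2 f" "f ` UNIV = ?E" "inj f"
    using P.finite_basis_to_basis_subspace_isomorphism[OF P.vs1.subspace_UNIV sub _ finB B finite_subset[OF C(1) finE] C]
      dim dimE by auto
  have add: "f (u + v) = f u + f v" and hom: "f (scale c v) = scale2 c (f v)" for u v c
    using f(1) unfolding Vector_Spaces.linear_iff by blast+
  have mem: "fst (f v) \<in> GF k" "snd (f v) \<in> GF k" for v
  proof -
    have "f v \<in> ?E" using f(2) by blast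
    thus "fst (f v) \<in> GF k" "snd (f v) \<in> GF k" by (auto simp: mem_Times_iff)
  qed
  have inv: "f (inv_into UNIV f (x, y)) = (x, y)" if "x \<in> GF k" "y \<in> GF k" for x y
    using that f(2) by (intro f_inv_into_f) auto
  have "coordinatized_space (GF k) to_ac scale (fst \<circ> f) (snd \<circ> f) (\<lambda>x y. inv_into UNIV f (x, y))"
    by unfold_locales
      (use finite_GF[OF k] vs in \<open>auto simp: to_ac mem inv add hom scale2_def inv_into_f_f[OF f(3)]\<close>)
  thus ?thesis using that by blast
qed

section \<open>Frobenius powers and semilinear maps\<close>

text \<open>The union subtracted in \<open>L\<close>: for positive \<open>k\<close>, the maps
  semilinear over some subfield of \<open>GF k\<close> strictly larger than
  \<open>GF l\<close>.\<close>

definition divisor_union :: "nat \<Rightarrow> nat \<Rightarrow> ('f::{field,finite} alg_closure \<Rightarrow> 'f alg_closure) set" where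
  "divisor_union k l = (\<Union>m \<in> {m. m dvd k \<and> l dvd m \<and> m \<noteq> l}. semilinear_ext k m)"

lemma finite_GL_ext: "k > 0 \<Longrightarrow> finite (GL_ext k l :: ('f::{field,finite} alg_closure \<Rightarrow> 'f alg_closure) set)"
proof -
  assume k: "k > 0"
  have "GL_ext k l \<subseteq> (GF k :: 'f alg_closure set) \<rightarrow>\<^sub>E GF k"
    by (auto simp: GL_ext_def PiE_def bij_betw_def)
  thus ?thesis by (rule finite_subset) (intro finite_PiE finite_GF k)
qed

lemma finite_semilinear_ext:
  "k > 0 \<Longrightarrow> finite (semilinear_ext k l :: ('f::{field,finite} alg_closure \<Rightarrow> 'f alg_closure) set)"
  by (rule finite_subset[OF _ finite_GL_ext[of k 1]]) (auto simp: semilinear_ext_def)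

lemma frobenius_bij:
  assumes "m > 0"
  shows "bij_betw (\<lambda>x. x ^ (CARD('f) ^ j)) (GF m) (GF m :: 'f::{field,finite} alg_closure set)"
proof -
  have "inj_on (\<lambda>x. x ^ (CARD('f) ^ j)) (GF m :: 'f alg_closure set)"
  proof (rule inj_onI)
    fix x y :: "'f alg_closure"
    assume "x ^ (CARD('f) ^ j) = y ^ (CARD('f) ^ j)"
    hence "(x + - y) ^ (CARD('f) ^ j) = 0" by (simp only: frobenius_add frobenius_uminus right_minus)
    thus "x = y" by simp
  qed
  moreover have "(\<lambda>x. x ^ (CARD('f) ^ j)) ` GF m \<subseteq> (GF m :: 'f alg_closure set)" by auto
  ultimately show ?thesis unfolding bij_betw_def by (simp add: endo_inj_surj finite_GF[OF assms])
qed

text \<open>Cancelling the injective Frobenius power with exponent \<open>i\<close> shows that the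
  one with exponent \<open>j - i\<close> fixes \<open>GF l\<close>, whence \<open>l\<close> divides
  \<open>j - i\<close>. Thus the powers with exponents below \<open>l\<close> are pairwise distinct
  on \<open>GF l\<close>.\<close>

lemma frobenius_eq_imp_le:
  assumes "l > 0" "i < j" "\<And>x :: 'f::{field,finite} alg_closure. x \<in> GF l \<Longrightarrow> x ^ (CARD('f) ^ i) = x ^ (CARD('f) ^ j)"
  shows "l \<le> j"
proof -
  have "GF l \<subseteq> (GF (j - i) :: 'f alg_closure set)"
  proof
    fix x :: "'f alg_closure" assume x: "x \<in> GF l"
    have "(x ^ (CARD('f) ^ (j - i))) ^ (CARD('f) ^ i) = x ^ (CARD('f) ^ j)"
      using assms(2) by (simp flip: power_mult power_add)
    hence "(x ^ (CARD('f) ^ (j - i))) ^ (CARD('f) ^ i) = x ^ (CARD('f) ^ i)" using assms(3)[OF x] by simp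
    moreover have "x ^ (CARD('f) ^ (j - i)) \<in> GF l" using x by (rule GF_power)
    ultimately have "x ^ (CARD('f) ^ (j - i)) = x"
      using x frobenius_bij[OF assms(1), of i, where 'f = 'f] unfolding bij_betw_def inj_on_def by blast
    thus "x \<in> GF (j - i)" by (simp add: GF_def)
  qed
  hence "l dvd j - i" using GF_subset_imp_dvd[OF assms(1)] by blast
  thus ?thesis using assms(2) by (meson diff_le_self dvd_imp_le le_trans zero_less_diff)
qed

lemma frobenius_in_Gal:
  assumes "l > 0"
  shows "(\<lambda>x\<in>GF l. x ^ (CARD('f) ^ j)) \<in> (Gal l :: ('f::{field,finite} alg_closure \<Rightarrow> 'f alg_closure) set)"
proof -
  have "x ^ (CARD('f) ^ j) = x" if "x \<in> GF 1" for x :: "'f alg_closure"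
    using power_CARD_mult[OF that, of j] by simp
  moreover have "GF 1 \<subseteq> (GF l :: 'f alg_closure set)" by (rule GF_mono) simp
  moreover have "bij_betw (\<lambda>x\<in>GF l. x ^ (CARD('f) ^ j)) (GF l) (GF l :: 'f alg_closure set)"
    using frobenius_bij[OF assms, of j, where 'f = 'f] by (simp cong: bij_betw_cong)
  ultimately show ?thesis
    unfolding Gal_def by (auto simp: frobenius_add power_mult_distrib GF_add GF_mult)
qed

text \<open>Composing the \<open>GF l\<close>-linear bijections with the Frobenius powers of
  exponent \<open>j < l\<close> on \<open>GF k\<close> gives pairwise distinct semilinear
  maps.\<close>

lemma card_semilinear_ext_ge:
  assumes k: "k > 0" and l: "l dvd k"
  shows "l * card (GL_ext k l :: ('f::{field,finite} alg_closure \<Rightarrow> 'f alg_closure) set)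
    \<le> card (semilinear_ext k l :: ('f alg_closure \<Rightarrow> 'f alg_closure) set)"
proof -
  let ?K = "GF k :: 'f alg_closure set"
  have l0: "l > 0" using k l by (simp add: dvd_pos_nat)
  have lK: "GF l \<subseteq> ?K" and bl: "GF 1 \<subseteq> (GF l :: 'f alg_closure set)"
    by (rule GF_mono, simp add: l)+
  define f where "f = (\<lambda>(j :: nat, \<psi> :: 'f alg_closure \<Rightarrow> 'f alg_closure). \<lambda>x\<in>?K. \<psi> x ^ (CARD('f) ^ j))"
  have D: "bij_betw \<psi> ?K ?K" "x \<in> ?K \<Longrightarrow> \<psi> x \<in> ?K" "x \<in> ?K \<Longrightarrow> y \<in> ?K \<Longrightarrow> \<psi> (x + y) = \<psi> x + \<psi> y"
    "v \<in> GF l \<Longrightarrow> x \<in> ?K \<Longrightarrow> \<psi> (v * x) = v * \<psi> x" "\<psi> \<in> extensional ?K"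
    if "\<psi> \<in> GL_ext k l" for \<psi> and x y v :: "'f alg_closure"
    using that by (auto simp: GL_ext_def bij_betw_def)
  have base: "v ^ (CARD('f) ^ j) = v" if "v \<in> GF 1" for v :: "'f alg_closure" and j
    using power_CARD_mult[OF that, of j] by simp
  have mem: "f (j, \<psi>) \<in> semilinear_ext k l" if \<psi>: "\<psi> \<in> GL_ext k l" for j \<psi>
  proof -
    have eq: "f (j, \<psi>) (v * x) = v ^ (CARD('f) ^ j) * f (j, \<psi>) x" if "v \<in> GF l" "x \<in> ?K" for v x :: "'f alg_closure"
    proof -
      have "v * x \<in> ?K" using that lK by blast
      thus ?thesis using that by (simp add: f_def D(4)[OF \<psi>] power_mult_distrib)
    qed
    have "bij_betw ((\<lambda>x. x ^ (CARD('f) ^ j)) \<circ> \<psi>) ?K ?K"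
      by (rule bij_betw_trans[OF D(1)[OF \<psi>] frobenius_bij[OF k]])
    hence bij: "bij_betw (f (j, \<psi>)) ?K ?K" by (simp add: f_def o_def cong: bij_betw_cong)
    have add: "f (j, \<psi>) (x + y) = f (j, \<psi>) x + f (j, \<psi>) y" if "x \<in> ?K" "y \<in> ?K" for x y
      using that by (simp add: f_def D(3)[OF \<psi>] frobenius_add GF_add)
    have "f (j, \<psi>) \<in> extensional ?K" by (simp add: f_def)
    hence "f (j, \<psi>) \<in> GL_ext k 1"
      unfolding GL_ext_def using bij add eq base bl by auto
    moreover have "\<forall>v\<in>GF l. \<forall>x\<in>?K. f (j, \<psi>) (v * x) = (\<lambda>x\<in>GF l. x ^ (CARD('f) ^ j)) v * f (j, \<psi>) x"
      using eq by simp
    ultimately show ?thesis unfolding semilinear_ext_def using frobenius_in_Gal[OF l0, of j, where 'f = 'f] by blast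
  qed
  have "inj_on f ({..<l} \<times> GL_ext k l)"
  proof (rule inj_onI, clarify)
    fix i j \<psi> \<chi> assume i: "i < l" and \<psi>: "\<psi> \<in> GL_ext k l" and j: "j < l" and \<chi>: "\<chi> \<in> GL_ext k l"
      and eq: "f (i, \<psi>) = f (j, \<chi>)"
    have eq': "\<psi> x ^ (CARD('f) ^ i) = \<chi> x ^ (CARD('f) ^ j)" if "x \<in> ?K" for x
      using fun_cong[OF eq, of x] that by (simp add: f_def)
    have "\<psi> 0 = \<psi> 0 + \<psi> 0" using D(3)[OF \<psi>, of 0 0] by simp
    hence "\<psi> 0 = 0" by (simp only: add_cancel_right_right)
    hence "\<psi> 1 \<noteq> 0" using D(1)[OF \<psi>] GF_0 GF_1 unfolding bij_betw_def inj_on_def by (metis zero_neq_one)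
    \<comment> \<open>Evaluating at \<open>v\<close> and at 1 and cancelling the nonzero power of
      \<open>\<psi> 1\<close> isolates the action on scalars.\<close>
    have pw: "v ^ (CARD('f) ^ i) = v ^ (CARD('f) ^ j)" if v: "v \<in> GF l" for v :: "'f alg_closure"
    proof -
      have vK: "v \<in> ?K" using v lK by blast
      have "\<psi> v = v * \<psi> 1" "\<chi> v = v * \<chi> 1" using D(4)[OF \<psi> v, of 1] D(4)[OF \<chi> v, of 1] by simp_all
      hence "v ^ (CARD('f) ^ i) * \<psi> 1 ^ (CARD('f) ^ i) = v ^ (CARD('f) ^ j) * \<chi> 1 ^ (CARD('f) ^ j)"
        using eq'[OF vK] by (simp add: power_mult_distrib)
      hence "v ^ (CARD('f) ^ i) * \<psi> 1 ^ (CARD('f) ^ i) = v ^ (CARD('f) ^ j) * \<psi> 1 ^ (CARD('f) ^ i)"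
        by (simp only: eq'[OF GF_1])
      thus ?thesis using \<open>\<psi> 1 \<noteq> 0\<close> by simp
    qed
    have ij: "i = j"
    proof (rule ccontr)
      assume "i \<noteq> j"
      hence "i < j \<or> j < i" by linarith
      thus False
        using frobenius_eq_imp_le[OF l0, of i j] frobenius_eq_imp_le[OF l0, of j i] pw i j by fastforce
    qed
    have "\<psi> x = \<chi> x" if "x \<in> ?K" for x
      using eq'[OF that] D(2)[OF \<psi> that] D(2)[OF \<chi> that] frobenius_bij[OF k, of j, where 'f = 'f]
      unfolding ij bij_betw_def inj_on_def by blast
    hence "\<psi> = \<chi>" using D(5)[OF \<psi>] D(5)[OF \<chi>] by (auto intro: extensionalityI)
    with ij show "i = j \<and> \<psi> = \<chi>" by simp
  qed
  moreover have "f ` ({..<l} \<times> GL_ext k l) \<subseteq> semilinear_ext k l" using mem by auto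
  ultimately have "card ({..<l} \<times> (GL_ext k l :: ('f alg_closure \<Rightarrow> 'f alg_closure) set)) \<le> card (semilinear_ext k l :: ('f alg_closure \<Rightarrow> 'f alg_closure) set)"
    by (rule card_inj_on_le) (rule finite_semilinear_ext[OF k])
  thus ?thesis by (simp add: card_cartesian_product)
qed

section \<open>Grouping GL(k,q) by normalized subfields\<close>

locale galois_coordinatized_space =
  coordinatized_space "GF k" "to_ac :: 'q::{field,finite} \<Rightarrow> 'q alg_closure" scale cx cy mk
  for k :: nat and scale :: "'q::{field,finite} \<Rightarrow> 'v::ab_group_add \<Rightarrow> 'v" and cx cy mk +
  assumes k_pos: "k > 0"
begin

abbreviation KK :: "'q alg_closure set" where "KK \<equiv> GF k"

lemma GLK_eq: "GLK = GL_ext k 1"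
proof -
  have "bij_betw \<phi> KK KK \<Longrightarrow> \<forall>x\<in>KK. \<phi> x \<in> KK" for \<phi> by (rule bij_betwE)
  thus ?thesis unfolding GLK_def HomK_def GL_ext_def GF_base by blast
qed

text \<open>A linear map is determined by its values on a basis of \<open>k\<close> elements, with
  q^k possible values for each.\<close>

lemma card_HomK_le: "card HomK \<le> CARD('q) ^ (k ^ 2)"
proof -
  interpret ac: vector_space "ac_scale :: 'q \<Rightarrow> 'q alg_closure \<Rightarrow> 'q alg_closure" by (rule vector_space_ac_scale)
  have sub: "ac.subspace KK"
    unfolding ac.subspace_def by (simp add: ac_scale_def)
  have "CARD('q) ^ ac.dim KK = CARD('q) ^ k"
    using card_subspace[OF vector_space_ac_scale sub finite_K] card_GF[OF k_pos, where 'f = 'q] by simp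
  hence dim: "ac.dim KK = k" using CARD_field_gt_1[where 'f = 'q] by simp
  obtain C where C: "C \<subseteq> KK" "ac.independent C" "KK \<subseteq> ac.span C" "card C = ac.dim KK"
    using ac.basis_exists by blast
  have finC: "finite C" using C(1) finite_K by (rule finite_subset)
  have "inj_on (\<lambda>\<phi>. restrict \<phi> C) HomK"
  proof (rule inj_onI)
    fix \<phi> \<psi> assume m: "\<phi> \<in> HomK" "\<psi> \<in> HomK" and eq: "restrict \<phi> C = restrict \<psi> C"
    have add: "\<phi> (x + y) = \<phi> x + \<phi> y" "\<psi> (x + y) = \<psi> x + \<psi> y" if "x \<in> KK" "y \<in> KK" for x y
      using that m by (auto simp: HomK_def)
    have hom: "\<phi> (to_ac c * x) = to_ac c * \<phi> x" "\<psi> (to_ac c * x) = to_ac c * \<psi> x" if "x \<in> KK" for x c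
      using that m by (auto simp: HomK_def)
    have z: "\<phi> 0 = 0" "\<psi> 0 = 0" using hom[OF K_0, of 0] by simp_all
    \<comment> \<open>The set where two linear maps agree is a subspace, so agreement on a basis
      extends to \<open>GF k\<close>.\<close>
    have "ac.subspace {x \<in> KK. \<phi> x = \<psi> x}"
      unfolding ac.subspace_def by (auto simp: ac_scale_def add hom z)
    moreover have "\<phi> x = \<psi> x" if "x \<in> C" for x using fun_cong[OF eq, of x] that by simp
    hence "C \<subseteq> {x \<in> KK. \<phi> x = \<psi> x}" using C(1) by blast
    ultimately have "ac.span C \<subseteq> {x \<in> KK. \<phi> x = \<psi> x}" by (rule ac.span_minimal[rotated])
    hence "\<phi> x = \<psi> x" if "x \<in> KK" for x using that C(3) by blast
    moreover have "\<phi> \<in> extensional KK" "\<psi> \<in> extensional KK" using m by (auto simp: HomK_def)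
    ultimately show "\<phi> = \<psi>" by (auto intro: extensionalityI)
  qed
  moreover have "(\<lambda>\<phi>. restrict \<phi> C) ` HomK \<subseteq> C \<rightarrow>\<^sub>E KK"
    using C(1) by (auto simp: HomK_def)
  moreover have "finite (C \<rightarrow>\<^sub>E KK)" by (intro finite_PiE finC finite_K)
  ultimately have "card HomK \<le> card (C \<rightarrow>\<^sub>E KK)" by (rule card_inj_on_le)
  also have "\<dots> = (CARD('q) ^ k) ^ k"
    using finC by (simp add: card_PiE C(4) dim card_GF[OF k_pos])
  finally show ?thesis by (simp add: power2_eq_square flip: power_mult)
qed

text \<open>Multipliers add and multiply along with their arguments, so the set is a finite subring
  containing the base field, hence some \<open>GF l\<close>; it lies in \<open>GF k\<close>.\<close>

lemma normalized_part_eq_GF: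
  assumes "\<phi> \<in> GLK"
  obtains l where "l dvd k" "normalized_part \<phi> = GF l"
proof -
  let ?A = "normalized_part \<phi>"
  note D = GLK_D[OF assms]
  have A: "?A \<subseteq> KK" by (auto simp: normalized_part_def)
  have base: "GF 1 \<subseteq> ?A"
    unfolding GF_base normalized_part_def using D(3) by auto
  have add: "x + y \<in> ?A" if "x \<in> ?A" "y \<in> ?A" for x y
  proof -
    from that obtain b c where b: "x \<in> KK" "b \<in> KK" "\<And>z. z \<in> KK \<Longrightarrow> \<phi> (x * z) = b * \<phi> z"
      and c: "y \<in> KK" "c \<in> KK" "\<And>z. z \<in> KK \<Longrightarrow> \<phi> (y * z) = c * \<phi> z"
      by (auto simp: normalized_part_def)
    have "\<phi> ((x + y) * z) = (b + c) * \<phi> z" if "z \<in> KK" for z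
      using that b c by (simp add: distrib_right D(2))
    thus ?thesis unfolding normalized_part_def using b c K_add by blast
  qed
  have mult: "x * y \<in> ?A" if "x \<in> ?A" "y \<in> ?A" for x y
  proof -
    from that obtain b c where b: "x \<in> KK" "b \<in> KK" "\<And>z. z \<in> KK \<Longrightarrow> \<phi> (x * z) = b * \<phi> z"
      and c: "y \<in> KK" "c \<in> KK" "\<And>z. z \<in> KK \<Longrightarrow> \<phi> (y * z) = c * \<phi> z"
      by (auto simp: normalized_part_def)
    have "\<phi> ((x * y) * z) = (b * c) * \<phi> z" if "z \<in> KK" for z
      using that b c by (simp add: mult.assoc)
    thus ?thesis unfolding normalized_part_def using b c K_mult by blast
  qed
  obtain l where l: "l > 0" "?A = GF l"
    using subring_eq_GF[OF finite_subset[OF A finite_K] base add mult] by blast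
  hence "GF l \<subseteq> KK" using A by simp
  hence "l dvd k" by (rule GF_subset_imp_dvd[OF l(1)])
  thus ?thesis using l(2) that by blast
qed

text \<open>The multiplier \<sigma> is determined by
  \<open>\<phi> v = \<sigma> v * \<phi> 1\<close>. Cancelling \<open>\<phi> 1\<close> shows that it
  is additive, multiplicative and trivial on the base field.\<close>

lemma semilinear_ext_if_normalized_part:
  assumes \<phi>: "\<phi> \<in> GLK" and m: "m dvd k" "normalized_part \<phi> = GF m"
  shows "\<phi> \<in> semilinear_ext k m"
proof -
  note D = GLK_D[OF \<phi>]
  have m0: "m > 0" using m k_pos by (simp add: dvd_pos_nat)
  have mK: "GF m \<subseteq> KK" by (rule GF_mono) (rule m)
  have "\<exists>c\<in>KK. \<forall>x\<in>KK. \<phi> (v * x) = c * \<phi> x" if "v \<in> GF m" for v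
    using that unfolding m(2)[symmetric] normalized_part_def by blast
  then obtain \<tau> where \<tau>: "\<And>v. v \<in> GF m \<Longrightarrow> \<tau> v \<in> KK" "\<And>v x. v \<in> GF m \<Longrightarrow> x \<in> KK \<Longrightarrow> \<phi> (v * x) = \<tau> v * \<phi> x"
    by metis
  define \<sigma> where "\<sigma> = restrict \<tau> (GF m)"
  have \<sigma>: "\<phi> (v * x) = \<sigma> v * \<phi> x" if "v \<in> GF m" "x \<in> KK" for v x
    using that \<tau> by (simp add: \<sigma>_def)
  have ne: "\<phi> 1 \<noteq> 0" using GLK_eq_0_iff[OF \<phi> K_1] by simp
  have \<sigma>1: "\<phi> v = \<sigma> v * \<phi> 1" if "v \<in> GF m" for v using \<sigma>[OF that K_1] by simp
  have eqI: "a = b" if "a * \<phi> 1 = b * \<phi> 1" for a b using that ne by simp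
  have add: "\<sigma> (u + v) = \<sigma> u + \<sigma> v" if "u \<in> GF m" "v \<in> GF m" for u v
  proof (rule eqI)
    have "\<sigma> (u + v) * \<phi> 1 = \<phi> (u + v)" by (rule \<sigma>1[OF GF_add[OF that], symmetric])
    also have "\<dots> = \<phi> u + \<phi> v" using that mK by (intro D(2)) auto
    finally show "\<sigma> (u + v) * \<phi> 1 = (\<sigma> u + \<sigma> v) * \<phi> 1" by (simp only: \<sigma>1[OF that(1)] \<sigma>1[OF that(2)] distrib_right)
  qed
  have mult: "\<sigma> (u * v) = \<sigma> u * \<sigma> v" if "u \<in> GF m" "v \<in> GF m" for u v
  proof (rule eqI)
    have "\<sigma> (u * v) * \<phi> 1 = \<phi> (u * v)" by (rule \<sigma>1[OF GF_mult[OF that], symmetric])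
    also have "\<dots> = \<sigma> u * \<phi> v" using that mK by (intro \<sigma>) auto
    finally show "\<sigma> (u * v) * \<phi> 1 = (\<sigma> u * \<sigma> v) * \<phi> 1" by (simp only: \<sigma>1[OF that(2)] mult.assoc)
  qed
  have base: "\<sigma> c = c" if c1: "c \<in> GF 1" for c
  proof (rule eqI)
    have c: "c \<in> GF m" using GF_mono[of 1 m] c1 by auto
    obtain d where "c = to_ac d" using c1 unfolding GF_base by blast
    hence "\<phi> c = c * \<phi> 1" using D(3)[OF K_1, of d] by simp
    thus "\<sigma> c * \<phi> 1 = c * \<phi> 1" by (simp only: \<sigma>1[OF c, symmetric])
  qed
  have pow: "\<sigma> (v ^ n) = \<sigma> v ^ n" if "v \<in> GF m" for v n
    by (induction n) (simp_all add: base[OF GF_1] mult[OF that GF_power[OF that]])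
  \<comment> \<open>A priori the values lie only in \<open>GF k\<close>; as \<sigma> commutes with
    powers, the equation defining \<open>GF m\<close> passes to them.\<close>
  have maps: "\<sigma> ` GF m \<subseteq> GF m"
  proof (rule image_subsetI)
    fix v :: "'q alg_closure" assume v: "v \<in> GF m"
    have "\<sigma> v ^ (CARD('q) ^ m) = \<sigma> (v ^ (CARD('q) ^ m))" by (rule pow[OF v, symmetric])
    thus "\<sigma> v \<in> GF m" using v by (simp add: GF_def)
  qed
  have "inj_on \<sigma> (GF m)"
  proof (rule inj_onI)
    fix u v assume uv: "u \<in> GF m" "v \<in> GF m" "\<sigma> u = \<sigma> v"
    have "\<phi> u = \<phi> v" by (simp only: \<sigma>1[OF uv(1)] \<sigma>1[OF uv(2)] uv(3))
    thus "u = v" using D(4) uv mK unfolding bij_betw_def inj_on_def by blast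
  qed
  hence "bij_betw \<sigma> (GF m) (GF m)"
    using maps endo_inj_surj[OF finite_GF[OF m0]] by (simp add: bij_betw_def)
  hence "\<sigma> \<in> Gal m" unfolding Gal_def using add mult base by (auto simp: \<sigma>_def)
  thus ?thesis unfolding semilinear_ext_def using \<phi> \<sigma> unfolding GLK_eq by blast
qed

lemma GF_subset_normalized_part:
  assumes "l dvd k" "\<phi> \<in> semilinear_ext k l"
  shows "GF l \<subseteq> normalized_part \<phi>"
proof
  fix v :: "'q alg_closure" assume v: "v \<in> GF l"
  have lK: "GF l \<subseteq> KK" by (rule GF_mono) (rule assms)
  obtain \<sigma> where \<sigma>: "\<sigma> \<in> Gal l" "\<forall>v\<in>GF l. \<forall>x\<in>KK. \<phi> (v * x) = \<sigma> v * \<phi> x"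
    using assms(2) by (auto simp: semilinear_ext_def)
  have "\<sigma> v \<in> GF l" using \<sigma>(1) v by (auto simp: Gal_def bij_betw_def)
  thus "v \<in> normalized_part \<phi>" unfolding normalized_part_def using v lK \<sigma>(2) by blast
qed

text \<open>Group the \<phi> by the \<open>l\<close> for which \<open>normalized_part \<phi>\<close>
  is \<open>GF l\<close>. The alternating sum is the deviation \<open>h l\<close> of the summand
  from 1/6. It is never positive, so a lower bound \<open>a l\<close> for the size of each group
  bounds the sum from above.\<close>

lemma sum_normalized_part_le:
  assumes N: "N = CARD('q) ^ k + 1"
  shows "(\<Sum>\<phi>\<in>GLK. 1 / (2 * (real (card (normalized_part \<phi>)) + 1))) \<le>
    1 / 6 * real (card GLK) +
    (\<Sum>i = 4..N. (-1) ^ (i + 1) / fact i *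
      (\<Sum>l | l dvd k. (real (card (GL_ext k l :: ('q alg_closure \<Rightarrow> 'q alg_closure) set))
          - real (card (divisor_union k l :: ('q alg_closure \<Rightarrow> 'q alg_closure) set)))
        * real l * falling (real CARD('q) ^ l - 2) (i - 3)))"
proof -
  let ?q = "CARD('q)"
  define a where "a l = (real (card (GL_ext k l :: ('q alg_closure \<Rightarrow> 'q alg_closure) set))
          - real (card (divisor_union k l :: ('q alg_closure \<Rightarrow> 'q alg_closure) set))) * real l" for l
  define h where "h l = 1 / (2 * (real (?q ^ l) + 1)) - 1 / 6" for l
  have fin: "finite {l. l dvd k}" using k_pos by simp
  have l0: "l > 0" if "l dvd k" for l using that k_pos by (simp add: dvd_pos_nat)
  have q: "2 \<le> ?q ^ l" if "l dvd k" for l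
    using CARD_field_gt_1[where 'f = 'q] l0[OF that] self_le_power[of ?q l] by linarith
  have h: "(\<Sum>i = 4..N. (-1) ^ (i + 1) / fact i * falling (real ?q ^ l - 2) (i - 3)) = h l" if "l dvd k" for l
  proof -
    have "?q ^ l \<le> ?q ^ k"
      using that k_pos CARD_field_gt_1[where 'f = 'q] by (intro power_increasing dvd_imp_le) auto
    thus ?thesis using alternating_falling_sum[OF q[OF that], of N] by (simp add: N h_def)
  qed
  \<comment> \<open>Rests on q^l \<ge> 2, with equality for q^l = 2.\<close>
  have h_neg: "h l \<le> 0" if "l dvd k" for l
  proof -
    have "2 \<le> real (?q ^ l)" using q[OF that] by linarith
    thus ?thesis unfolding h_def by (simp add: field_simps)
  qed
  have "\<forall>\<phi>\<in>GLK. \<exists>l. l dvd k \<and> normalized_part \<phi> = GF l" using normalized_part_eq_GF by blast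
  then obtain lev where lev: "\<And>\<phi>. \<phi> \<in> GLK \<Longrightarrow> lev \<phi> dvd k" "\<And>\<phi>. \<phi> \<in> GLK \<Longrightarrow> normalized_part \<phi> = GF (lev \<phi>)"
    by metis
  \<comment> \<open>Only one copy of the union has to be subtracted from the semilinear maps; subtracting it \<open>l\<close>
      times, as \<open>a l\<close> does, is harmless since \<open>h l \<le> 0\<close>.\<close>
  have a_le: "a l \<le> real (card {\<phi> \<in> GLK. lev \<phi> = l})" if l: "l dvd k" for l
  proof -
    let ?S = "semilinear_ext k l :: ('q alg_closure \<Rightarrow> 'q alg_closure) set"
    let ?U = "divisor_union k l :: ('q alg_closure \<Rightarrow> 'q alg_closure) set"
    \<comment> \<open>A map semilinear over \<open>GF l\<close> has a level divisible by
      \<open>l\<close>; at a proper multiple it would belong to \<open>?U\<close>.\<close>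
    have "?S - ?U \<subseteq> {\<phi> \<in> GLK. lev \<phi> = l}"
    proof
      fix \<phi> assume \<phi>: "\<phi> \<in> ?S - ?U"
      hence G: "\<phi> \<in> GLK" by (simp add: GLK_eq semilinear_ext_def)
      have "GF l \<subseteq> (GF (lev \<phi>) :: 'q alg_closure set)"
        using GF_subset_normalized_part[OF l, of \<phi>] \<phi> lev(2)[OF G] by simp
      hence dvd: "l dvd lev \<phi>" by (rule GF_subset_imp_dvd[OF l0[OF l]])
      have "\<phi> \<in> semilinear_ext k (lev \<phi>)"
        by (rule semilinear_ext_if_normalized_part[OF G lev(1)[OF G] lev(2)[OF G]])
      hence "lev \<phi> = l" using \<phi> dvd lev(1)[OF G] by (auto simp: divisor_union_def)
      with G show "\<phi> \<in> {\<phi> \<in> GLK. lev \<phi> = l}" by simp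
    qed
    hence "card (?S - ?U) \<le> card {\<phi> \<in> GLK. lev \<phi> = l}" by (rule card_mono[rotated]) (simp add: finite_GLK)
    moreover have "finite ?U"
      unfolding divisor_union_def using k_pos by (auto intro!: finite_semilinear_ext)
    hence "card ?S - card ?U \<le> card (?S - ?U)" by (rule diff_card_le_card_Diff)
    moreover have "l * card (GL_ext k l :: ('q alg_closure \<Rightarrow> 'q alg_closure) set) \<le> card ?S"
      by (rule card_semilinear_ext_ge[OF k_pos l])
    moreover have "card ?U \<le> l * card ?U" using l0[OF l] by simp
    ultimately have "l * card (GL_ext k l :: ('q alg_closure \<Rightarrow> 'q alg_closure) set)
        \<le> card {\<phi> \<in> GLK. lev \<phi> = l} + l * card ?U" by linarith
    hence "real (l * card (GL_ext k l :: ('q alg_closure \<Rightarrow> 'q alg_closure) set))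
        \<le> real (card {\<phi> \<in> GLK. lev \<phi> = l} + l * card ?U)"
      by (simp only: of_nat_le_iff)
    thus ?thesis by (simp add: a_def algebra_simps)
  qed
  have "(\<Sum>\<phi>\<in>GLK. 1 / (2 * (real (card (normalized_part \<phi>)) + 1))) - 1 / 6 * real (card GLK) = (\<Sum>\<phi>\<in>GLK. h (lev \<phi>))"
  proof -
    have "h (lev \<phi>) = 1 / (2 * (real (card (normalized_part \<phi>)) + 1)) - 1 / 6" if "\<phi> \<in> GLK" for \<phi>
      using lev[OF that] l0 by (simp add: h_def card_GF)
    thus ?thesis by (simp add: sum_subtractf)
  qed
  also have "\<dots> = (\<Sum>l | l dvd k. \<Sum>\<phi> | \<phi> \<in> GLK \<and> lev \<phi> = l. h (lev \<phi>))"
    using lev(1) by (intro sum.group[symmetric] finite_GLK fin) auto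
  also have "\<dots> = (\<Sum>l | l dvd k. real (card {\<phi> \<in> GLK. lev \<phi> = l}) * h l)" by simp
  also have "\<dots> \<le> (\<Sum>l | l dvd k. a l * h l)"
    by (intro sum_mono mult_right_mono_neg a_le h_neg) simp_all
  also have "\<dots> = (\<Sum>l | l dvd k. \<Sum>i = 4..N. a l * ((-1) ^ (i + 1) / fact i * falling (real ?q ^ l - 2) (i - 3)))"
    by (intro sum.cong refl) (simp add: h[symmetric] sum_distrib_left)
  also have "\<dots> = (\<Sum>i = 4..N. \<Sum>l | l dvd k. a l * ((-1) ^ (i + 1) / fact i * falling (real ?q ^ l - 2) (i - 3)))"
    by (rule sum.swap)
  also have "\<dots> = (\<Sum>i = 4..N. (-1) ^ (i + 1) / fact i * (\<Sum>l | l dvd k. a l * falling (real ?q ^ l - 2) (i - 3)))"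
    by (simp add: sum_distrib_left mult_ac)
  finally show ?thesis by (simp add: a_def)
qed

end

section \<open>The lower bound for partial parallelisms\<close>

theorem theorem3p2:
  fixes scale :: "'f::{field,finite} \<Rightarrow> 'v::ab_group_add \<Rightarrow> 'v"
    and q k N :: nat and L :: real
  assumes q: "q = CARD('f)"
    and k: "k > 0"
    and V: "vector_space scale" "vector_space.dim scale (UNIV :: 'v set) = 2 * k"
    and N: "N = q ^ k + 1"
    and L: "L =
      real N ^ 2 * real q ^ (k ^ 2)
          * real (card (GL_ext k 1 :: ('f alg_closure \<Rightarrow> 'f alg_closure) set)) ^ 2
      - 1 / 2 * (real N * (real N - 1)) ^ 2
          * real (card (GL_ext k 1 :: ('f alg_closure \<Rightarrow> 'f alg_closure) set)) ^ 2
      + 1 / fact 3 * (real N * (real N - 1) * (real N - 2)) ^ 2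
          * real (card (GL_ext k 1 :: ('f alg_closure \<Rightarrow> 'f alg_closure) set))
      + (\<Sum>i = 4..N. (-1) ^ (i + 1) / fact i
          * (real N * (real N - 1) * (real N - 2)) ^ 2
          * (\<Sum>l | l dvd k.
              (real (card (GL_ext k l :: ('f alg_closure \<Rightarrow> 'f alg_closure) set))
               - real (card (\<Union>m \<in> {m. m dvd k \<and> l dvd m \<and> m \<noteq> l}.
                   semilinear_ext k m :: ('f alg_closure \<Rightarrow> 'f alg_closure) set)))
              * real l * falling (real q ^ l - 2) (i - 3)))"
  shows "real (max_k_parallelism scale k) \<ge> real (card (general_linear scale)) / L"
proof -
  obtain cx cy :: "'v \<Rightarrow> 'f alg_closure" and mk
    where C: "coordinatized_space (GF k) to_ac scale cx cy mk"
    using ex_coordinates[OF k V] by blast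
  interpret galois_coordinatized_space k scale cx cy mk
    using C k by (simp add: galois_coordinatized_space_def galois_coordinatized_space_axioms_def)
  let ?g = "real (card GLK)" and ?T = "(real N * (real N - 1) * (real N - 2)) ^ 2"
  let ?X = "{g \<in> G. meets g > 0}"
  define R where "R = (\<Sum>i = 4..N. (-1) ^ (i + 1) / fact i *
      (\<Sum>l | l dvd k. (real (card (GL_ext k l :: ('f alg_closure \<Rightarrow> 'f alg_closure) set))
          - real (card (divisor_union k l :: ('f alg_closure \<Rightarrow> 'f alg_closure) set)))
        * real l * falling (real CARD('f) ^ l - 2) (i - 3)))"
  have cardD: "card D = N" by (simp add: card_D card_GF[OF k] N q)
  have HomK: "real (card HomK) \<le> real q ^ (k ^ 2)"
    using card_HomK_le by (metis of_nat_le_iff of_nat_power q)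
  have "real (card ?X) \<le> real N ^ 2 * (real (card HomK) * ?g ^ 2) - 1 / 2 * (real N * (real N - 1)) ^ 2 * ?g ^ 2
     + ?T * (\<Sum>\<phi>\<in>GLK. 1 / (2 * (real (card (normalized_part \<phi>)) + 1)))"
    using card_meets_pos_le unfolding cardD .
  also have "\<dots> \<le> real N ^ 2 * (real q ^ (k ^ 2) * ?g ^ 2) - 1 / 2 * (real N * (real N - 1)) ^ 2 * ?g ^ 2
     + ?T * (1 / 6 * ?g + R)"
    using sum_normalized_part_le[OF N[unfolded q]]
    by (intro add_mono diff_mono mult_left_mono mult_right_mono HomK) (simp_all add: R_def)
  \<comment> \<open>The summand with factor 1/6 is the term of \<open>L\<close> with 1/3!.\<close>
  also have "\<dots> = L"
    unfolding L R_def divisor_union_def GLK_eq q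
    by (simp add: sum_distrib_left algebra_simps fact_numeral)
  finally have XL: "real (card ?X) \<le> L" .
  obtain M where M: "M \<subseteq> G"
    "\<And>g h. g \<in> M \<Longrightarrow> h \<in> M \<Longrightarrow> g \<noteq> h \<Longrightarrow> disjnt ((`) g ` D) ((`) h ` D)"
    "card G \<le> card M * card ?X"
    using greedy by blast
  \<comment> \<open>Positivity of \<open>L\<close> for the division: the group contains the identity
    and is covered by translates of \<open>?X\<close>, so \<open>?X\<close> is nonempty.\<close>
  have "card G > 0" using G_id finite_G by (auto simp: card_gt_0_iff)
  hence "card ?X > 0" using M(3) by (cases "card ?X") auto
  hence L0: "L > 0" using XL by linarith
  have "real (card G) \<le> real (card M * card ?X)" using M(3) by (simp only: of_nat_le_iff)
  also have "\<dots> \<le> real (card M) * L" using XL by (simp add: mult_left_mono)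
  finally have bound: "real (card G) / L \<le> real (card M)" using L0 by (simp add: divide_le_eq)

  define \<P> where "\<P> = (\<lambda>g. (`) g ` D) ` M"
  have spread: "k_spread scale k ((`) g ` D)" if "g \<in> M" for g
  proof -
    have g: "g \<in> G" using that M(1) by blast
    have "vector_space.dim scale W = k" if W: "W \<in> (`) g ` D" for W
    proof -
      have "finite W" using finite_V by (rule finite_subset[rotated]) simp
      hence "CARD('f) ^ vector_space.dim scale W = CARD('f) ^ k"
        using card_subspace[OF V(1) subspace_image_D(1)[OF g W]] card_image_D[OF g W] by (simp add: card_GF[OF k])
      thus ?thesis using CARD_field_gt_1[where 'f = 'f] by simp
    qed
    thus ?thesis unfolding k_spread_def using subspace_image_D(1)[OF g] ex1_image_D[OF g] by blast
  qed
  \<comment> \<open>Distinct elements of \<open>M\<close> give distinct spreads, since two equal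
    disjoint families would be empty.\<close>
  have "D \<noteq> {}" using card_D_ge_3 by auto
  hence "inj_on (\<lambda>g. (`) g ` D) M"
    using M(2) by (intro inj_onI) (metis disjnt_self_iff_empty image_is_empty)
  hence card: "card \<P> = card M" unfolding \<P>_def by (rule card_image)
  have "partial_k_parallelism scale k \<P>"
    unfolding partial_k_parallelism_def \<P>_def pairwise_image
    using spread M(2) by (auto simp: pairwise_def)
  hence "card \<P> \<in> card ` {\<P>. partial_k_parallelism scale k \<P>}" by blast
  \<comment> \<open>The space is finite, so the maximum is over a finite set and bounds each of its
    members.\<close>
  moreover have "finite {\<P>. partial_k_parallelism scale k \<P>}"
    by (rule finite_subset[OF subset_UNIV]) (simp add: finite_V Finite_Set.finite_set)
  ultimately have "card M \<le> max_k_parallelism scale k"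
    unfolding max_k_parallelism_def card[symmetric] by (intro Max_ge finite_imageI)
  with bound show ?thesis by linarith
qed

end
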